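(* Suppose two-phase HotStuff, with leader-wait timeout function $F_p$, is run with a synchronizer satisfying the specification (P1)-(P5) given in the context for a view $\mathcal V$ and $d=2\delta$. Let $v\ge\mathcal V$ be a view such that $F_p(v)>3\delta$, $F(v)-F_p(v)>5\delta$ and $\mathsf{leader}(v)$ is correct. Then all correct processes decide at $v$ by time $E_{\rm last}(v)+F_p(v)+3\delta$.
   Context: Model. There are $n=3f+1$ processes $p_1,\dots,p_n$, at most $f$ of which are faulty (Byzantine, behaving arbitrarily); the others are correct. A quorum is a set of $2f+1$ processes. Processes communicate over authenticated point-to-point links. Partial synchrony: there are a time $\mathsf{GST}$ and a bound $\delta$, both unknown to the protocol, such that after $\mathsf{GST}$ messages between correct processes are delayed by at most $\delta$; before $\mathsf{GST}$ messages may be arbitrarily delayed or lost (self-addressed messages are never lost). Local clocks may drift unboundedly before $\mathsf{GST}$ and do not drift from real time after it. Local processing takes zero time. $\langle m\rangle_i$ denotes $m$ signed by $p_i$; signatures are unforgeable and $\mathsf{hash}$ is collision-resistant (both idealized as perfect). Each correct process has a proposal $\mathtt{myval}()$ satisfying a given predicate $\mathsf{valid}$. Synchronizer. Views are $1,2,\dots$; $0$ denotes an invalid view. A synchronizer issues notifications $\mathtt{new\_view}(v)$ at each correct process, which then enters $v$ and stays in it until it enters another view. Each correct process eventually calls the synchronizer's function $\mathtt{start}()$. The timeout function $F:\{0,1,2,\dots\}\to\mathsf{Time}$ is monotone, $F(0)=0$, and for every $\theta$ there is $v$ with $F(v')>\theta$ for all $v'\ge v$. $E_i(v)$ is the time when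 correct $p_i$ enters $v$; $E_{\rm first}(v)$, $E_{\rm last}(v)$ are the earliest and latest times when some correct process enters $v$. Specification, for a view $\mathcal V$: (P1) if $v<v'$ and $E_i(v),E_i(v')$ are defined then $E_i(v)<E_i(v')$; (P2) $E_{\rm first}(\mathcal V)\ge\mathsf{GST}$; (P3) every correct process enters every $v\ge\mathcal V$; (P4) $E_{\rm last}(v)\le E_{\rm first}(v)+d$ for all $v\ge\mathcal V$; (P5) $E_{\rm first}(v+1)\ge E_{\rm first}(v)+F(v)$ for all $v\ge\mathcal V$. Two-phase HotStuff (code of $p_i$). $\mathsf{leader}(v)=p_{((v-1)\bmod n)+1}$. Variables $\mathsf{curr\_view},\mathsf{prepared\_view},\mathsf{locked\_view}$ are initially $0$; $\mathsf{curr\_val},\mathsf{prepared\_val},\mathsf{cert},\mathsf{voted}$ are initially $\bot$; $\mathsf{timer\_newleader}$ is a timer. A handler runs when its trigger and precondition hold; messages for views higher than the current one are buffered (for each type and sender, only the one with the highest view is kept). "All" includes the sender. 1. Upon $\mathtt{new\_view}(v)$: $\mathsf{curr\_view}:=v$; $\mathsf{voted}:=$ false; stop $\mathsf{timer\_newleader}$; if $p_i=\mathsf{leader}(v)$, start $\mathsf{timer\_newleader}$ with duration $F_p(v)$; send $\langle\mathtt{NEWLEADER}(v,\mathsf{prepared\_view},\mathsf{prepared\_val},\mathsf{cert})\rangle_i$ to $\mathsf{leader}(v)$. 2. (Once per view.) When $\mathsf{timer\_newleader}$ has expired, with $\mathsf{curr\_view}=v$ and $p_i=\mathsf{leader}(v)$: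 let $M=\{\langle\mathtt{NEWLEADER}(v,view_j,val_j,cert_j)\rangle_j\mid p_j\in P\}$ be the set of all received messages for $v$ satisfying ValidNewLeader; if there is $j$ with $view_j=\max\{view_k\mid p_k\in P\}\ne0$, send $\langle\mathtt{PROPOSE}(v,val_j,cert_j)\rangle_i$ to all; else send $\langle\mathtt{PROPOSE}(v,\mathtt{myval}(),\bot)\rangle_i$ to all. 3. When $m=\langle\mathtt{PROPOSE}(v,x,\_)\rangle_j$ is received, with $\mathsf{curr\_view}=v$, $\mathsf{voted}=$ false, SafeProposal$(m)$: $\mathsf{curr\_val}:=x$; $\mathsf{voted}:=$ true; send $\langle\mathtt{PREPARED}(v,\mathsf{hash}(x))\rangle_i$ to all. 4. When $C=\{\langle\mathtt{PREPARED}(v,h)\rangle_j\mid p_j\in Q\}$ is received for a quorum $Q$, with $\mathsf{curr\_view}=v$, $\mathsf{voted}=$ true, $\mathsf{hash}(\mathsf{curr\_val})=h$: $\mathsf{prepared\_val}:=\mathsf{curr\_val}$; $\mathsf{prepared\_view}:=v$; $\mathsf{locked\_view}:=v$; $\mathsf{cert}:=C$; send $\langle\mathtt{COMMITTED}(v,h)\rangle_i$ to all. 5. When $\{\langle\mathtt{COMMITTED}(v,h)\rangle_j\mid p_j\in Q\}$ is received for a quorum $Q$, with $\mathsf{curr\_view}=\mathsf{locked\_view}=v$, $\mathsf{hash}(\mathsf{curr\_val})=h$: decide $\mathsf{curr\_val}$. View-1 optimization: the leader of view $1$ sends $\langle\mathtt{PROPOSE}(1,\mathtt{myval}(),\bot)\rangle_i$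 immediately on entering view $1$, without waiting. Predicates: prepared$(C,v,h)$ iff $C=\{\langle\mathtt{PREPARED}(v,h)\rangle_j\mid p_j\in Q\}$ for some quorum $Q$. ValidNewLeader$(\langle\mathtt{NEWLEADER}(v',v,x,C)\rangle_{\_})$ iff $v<v'$ and ($v\ne0$ implies prepared$(C,v,\mathsf{hash}(x))$). SafeProposal$(\langle\mathtt{PROPOSE}(v,x,C)\rangle_i)$, evaluated at the receiving process, iff $p_i=\mathsf{leader}(v)$, $\mathsf{valid}(x)$, and ($\mathsf{locked\_view}\ne0$ implies that $x=\mathsf{prepared\_val}$ or there is $v'$ with $v>v'>\mathsf{locked\_view}$ and prepared$(C,v',\mathsf{hash}(x))$). *)

theory Defs
  imports Complex_Main
begin

text \<open>
  Processes are the numbers \<open>1, \<dots>, 3 * max_faulty + 1\<close>; views are natural numbers, 0 being the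
  invalid view; time is real; \<open>\<bottom>\<close> is \<open>None\<close>. Values have type \<open>'v\<close>, hashes type \<open>'h\<close>.
\<close>

type_synonym pid = nat
type_synonym view = nat

text \<open>
  An element \<open>(j, v, h)\<close> of a certificate is the signed message
  \<open>\<langle>PREPARED v h\<rangle>\<^sub>j\<close> (see \<open>signed_parts\<close> below).
\<close>

type_synonym 'h cert = "(pid \<times> view \<times> 'h) set"

datatype ('v, 'h) msg =
    NEWLEADER view view "'v option" "'h cert option"
  | PROPOSE view 'v "'h cert option"
  | PREPARED view 'h
  | COMMITTED view 'h

text \<open>The pair \<open>(i, m)\<close> is \<open>\<langle>m\<rangle>\<^sub>i\<close>, the message \<open>m\<close> signed by process \<open>i\<close>.\<close>

type_synonym ('v, 'h) smsg = "pid \<times> ('v, 'h) msg"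

datatype msg_type = NEWLEADER_type | PROPOSE_type | PREPARED_type | COMMITTED_type

fun type_of :: "('v, 'h) msg \<Rightarrow> msg_type" where
  "type_of (NEWLEADER _ _ _ _) = NEWLEADER_type"
| "type_of (PROPOSE _ _ _) = PROPOSE_type"
| "type_of (PREPARED _ _) = PREPARED_type"
| "type_of (COMMITTED _ _) = COMMITTED_type"

fun view_of :: "('v, 'h) msg \<Rightarrow> view" where
  "view_of (NEWLEADER v _ _ _) = v"
| "view_of (PROPOSE v _ _) = v"
| "view_of (PREPARED v _) = v"
| "view_of (COMMITTED v _) = v"

definition cert_parts :: "'h cert option \<Rightarrow> ('v, 'h) smsg set" where
  "cert_parts C = {(j, PREPARED v h) | j v h. \<exists>D. C = Some D \<and> (j, v, h) \<in> D}"

fun signed_parts :: "('v, 'h) smsg \<Rightarrow> ('v, 'h) smsg set" where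
  "signed_parts (i, NEWLEADER v w y C) = insert (i, NEWLEADER v w y C) (cert_parts C)"
| "signed_parts (i, PROPOSE v x C) = insert (i, PROPOSE v x C) (cert_parts C)"
| "signed_parts (i, PREPARED v h) = {(i, PREPARED v h)}"
| "signed_parts (i, COMMITTED v h) = {(i, COMMITTED v h)}"

record ('v, 'h) params =
  max_faulty :: nat
  hash :: "'v \<Rightarrow> 'h"
  valid :: "'v \<Rightarrow> bool"
  myval :: "pid \<Rightarrow> 'v"
  Fp :: "view \<Rightarrow> real"

definition nprocs :: "('v, 'h) params \<Rightarrow> nat" where
  "nprocs P = 3 * max_faulty P + 1"

definition procs :: "('v, 'h) params \<Rightarrow> pid set" where
  "procs P = {1..nprocs P}"

definition quorum :: "('v, 'h) params \<Rightarrow> pid set \<Rightarrow> bool" where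
  "quorum P Q \<longleftrightarrow> Q \<subseteq> procs P \<and> card Q = 2 * max_faulty P + 1"

definition leader :: "('v, 'h) params \<Rightarrow> view \<Rightarrow> pid" where
  "leader P v = (v - 1) mod nprocs P + 1"

subsection \<open>The code of a correct process\<close>

text \<open>
  Handler triggers other than \<open>new_view\<close>; each value is one instance of the trigger.
  \<open>PreparedQuorum Q v h\<close> stands for \<open>{\<langle>PREPARED v h\<rangle>\<^sub>j | j \<in> Q}\<close>, and similarly for
  \<open>CommittedQuorum\<close>.
\<close>

datatype ('v, 'h) trigger =
    LeaderTimeout view
  | ProposeReceived "('v, 'h) smsg"
  | PreparedQuorum "pid set" view 'h
  | CommittedQuorum "pid set" view 'h

text \<open>
  \<open>timer = Some l\<close> means that \<open>timer_newleader\<close> was started and expires when the local clock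
  reaches \<open>l\<close>. \<open>received\<close> holds the messages received for the current view together with the
  buffered messages for higher views (earlier leftovers are never used again). \<open>handled\<close> is a
  history variable: the trigger instances whose handler has run, so that a handler runs once
  per instance (for \<open>LeaderTimeout\<close>: once per view).
\<close>

record ('v, 'h) pstate =
  curr_view :: view
  prepared_view :: view
  locked_view :: view
  curr_val :: "'v option"
  prepared_val :: "'v option"
  cert :: "'h cert option"
  voted :: "bool option"
  timer :: "real option"
  received :: "('v, 'h) smsg set"
  handled :: "('v, 'h) trigger set"

definition init_state :: "('v, 'h) pstate" where
  "init_state = \<lparr>curr_view = 0, prepared_view = 0, locked_view = 0, curr_val = None,
     prepared_val = None, cert = None, voted = None, timer = None, received = {}, handled = {}\<rparr>"

text \<open>\<open>Send i j m\<close>: a packet from \<open>i\<close> to \<open>j\<close>; \<open>Decide i x\<close>: process \<open>i\<close> decides \<open>x\<close>.\<close>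

datatype ('v, 'h) action = Send pid pid "('v, 'h) smsg" | Decide pid 'v

definition send_to :: "pid \<Rightarrow> pid \<Rightarrow> ('v, 'h) msg \<Rightarrow> ('v, 'h) action" where
  "send_to i j m = Send i j (i, m)"

definition send_all :: "('v, 'h) params \<Rightarrow> pid \<Rightarrow> ('v, 'h) msg \<Rightarrow> ('v, 'h) action set" where
  "send_all P i m = {send_to i j m | j. j \<in> procs P}"

definition prepared_cert :: "pid set \<Rightarrow> view \<Rightarrow> 'h \<Rightarrow> 'h cert" where
  "prepared_cert Q v h = {(j, v, h) | j. j \<in> Q}"

definition prepared :: "('v, 'h) params \<Rightarrow> 'h cert option \<Rightarrow> view \<Rightarrow> 'h \<Rightarrow> bool" where
  "prepared P C v h \<longleftrightarrow> (\<exists>Q. quorum P Q \<and> C = Some (prepared_cert Q v h))"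

fun valid_new_leader :: "('v, 'h) params \<Rightarrow> ('v, 'h) msg \<Rightarrow> bool" where
  "valid_new_leader P (NEWLEADER v' v y C) \<longleftrightarrow>
     v < v' \<and> (v \<noteq> 0 \<longrightarrow> (\<exists>x. y = Some x \<and> prepared P C v (hash P x)))"
| "valid_new_leader P _ \<longleftrightarrow> False"

fun safe_proposal :: "('v, 'h) params \<Rightarrow> ('v, 'h) pstate \<Rightarrow> ('v, 'h) smsg \<Rightarrow> bool" where
  "safe_proposal P s (i, PROPOSE v x C) \<longleftrightarrow>
     i = leader P v \<and> valid P x \<and>
     (locked_view s \<noteq> 0 \<longrightarrow>
        Some x = prepared_val s \<or>
        (\<exists>v'. v > v' \<and> v' > locked_view s \<and> prepared P C v' (hash P x)))"
| "safe_proposal P s _ \<longleftrightarrow> False"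

text \<open>
  The \<open>new_view(v)\<close> handler at process \<open>i\<close>, whose local clock shows \<open>c\<close>, with the optimization that the leader of
  view 1 proposes at once, without waiting for the timer.
\<close>

definition enter_view ::
  "('v, 'h) params \<Rightarrow> pid \<Rightarrow> real \<Rightarrow> view \<Rightarrow> ('v, 'h) pstate \<Rightarrow> ('v, 'h) pstate" where
  "enter_view P i c v s = s\<lparr>curr_view := v, voted := Some False,
     timer := if i = leader P v \<and> v \<noteq> 1 then Some (c + Fp P v) else None\<rparr>"

definition enter_view_out ::
  "('v, 'h) params \<Rightarrow> pid \<Rightarrow> view \<Rightarrow> ('v, 'h) pstate \<Rightarrow> ('v, 'h) action set" where
  "enter_view_out P i v s =
     {send_to i (leader P v) (NEWLEADER v (prepared_view s) (prepared_val s) (cert s))} \<union>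
     (if v = 1 \<and> i = leader P 1 then send_all P i (PROPOSE 1 (myval P i) None) else {})"

text \<open>
  Reception of a message. Stale messages are dropped. Among the buffered messages, at most one
  of each type and signer is kept, namely the one for the highest view; if a signer equivocates
  within one view, either message may be kept.
\<close>

definition buffered_same_slot ::
  "('v, 'h) pstate \<Rightarrow> ('v, 'h) smsg \<Rightarrow> ('v, 'h) smsg set" where
  "buffered_same_slot s m = {m' \<in> received s. fst m' = fst m \<and>
     type_of (snd m') = type_of (snd m) \<and> curr_view s < view_of (snd m')}"

definition receive ::
  "('v, 'h) pstate \<Rightarrow> ('v, 'h) smsg \<Rightarrow> ('v, 'h) pstate \<Rightarrow> bool" where
  "receive s m s' \<longleftrightarrow>
     (let u = view_of (snd m); B = buffered_same_slot s m in
      if u < curr_view s then s' = s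
      else if u = curr_view s then s' = s\<lparr>received := insert m (received s)\<rparr>
      else (s' = s\<lparr>received := insert m (received s - B)\<rparr> \<and> (\<forall>m' \<in> B. view_of (snd m') \<le> u)) \<or>
           (s' = s \<and> (\<exists>m' \<in> B. u \<le> view_of (snd m'))))"

text \<open>Trigger and precondition of a handler at process \<open>i\<close> with local clock \<open>c\<close>.\<close>

fun guard ::
  "('v, 'h) params \<Rightarrow> pid \<Rightarrow> real \<Rightarrow> ('v, 'h) pstate \<Rightarrow> ('v, 'h) trigger \<Rightarrow> bool" where
  "guard P i c s (LeaderTimeout v) \<longleftrightarrow>
     (\<exists>l. timer s = Some l \<and> l \<le> c) \<and> curr_view s = v \<and> i = leader P v"
| "guard P i c s (ProposeReceived m) \<longleftrightarrow>
     m \<in> received s \<and> curr_view s = view_of (snd m) \<and> voted s = Some False \<and> safe_proposal P s m"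
| "guard P i c s (PreparedQuorum Q v h) \<longleftrightarrow>
     quorum P Q \<and> (\<forall>j \<in> Q. (j, PREPARED v h) \<in> received s) \<and>
     curr_view s = v \<and> voted s = Some True \<and> map_option (hash P) (curr_val s) = Some h"
| "guard P i c s (CommittedQuorum Q v h) \<longleftrightarrow>
     quorum P Q \<and> (\<forall>j \<in> Q. (j, COMMITTED v h) \<in> received s) \<and>
     curr_view s = v \<and> locked_view s = v \<and> map_option (hash P) (curr_val s) = Some h"

definition enabled ::
  "('v, 'h) params \<Rightarrow> pid \<Rightarrow> real \<Rightarrow> ('v, 'h) pstate \<Rightarrow> ('v, 'h) trigger \<Rightarrow> bool" where
  "enabled P i c s g \<longleftrightarrow> guard P i c s g \<and> g \<notin> handled s"

text \<open>
  The set \<open>M\<close> of the leader, each \<open>\<langle>NEWLEADER v w y C\<rangle>\<^sub>j\<close> given as \<open>(j, w, y, C)\<close>, and the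
  proposals the leader may make on the basis of it.
\<close>

definition new_leader_msgs ::
  "('v, 'h) params \<Rightarrow> ('v, 'h) pstate \<Rightarrow> view \<Rightarrow> (pid \<times> view \<times> 'v option \<times> 'h cert option) set" where
  "new_leader_msgs P s v = {(j, w, y, C). (j, NEWLEADER v w y C) \<in> received s \<and>
     valid_new_leader P (NEWLEADER v w y C)}"

definition leader_proposal ::
  "('v, 'h) params \<Rightarrow> pid \<Rightarrow> ('v, 'h) pstate \<Rightarrow> view \<Rightarrow> ('v, 'h) msg \<Rightarrow> bool" where
  "leader_proposal P i s v m \<longleftrightarrow>
     (let M = new_leader_msgs P s v;
          best = (\<lambda>(j, w, y, C). w \<noteq> 0 \<and> (\<forall>(j', w', y', C') \<in> M. w' \<le> w))
      in if \<exists>q \<in> M. best q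
         then \<exists>j w x C. (j, w, Some x, C) \<in> M \<and> best (j, w, Some x, C) \<and> m = PROPOSE v x C
         else m = PROPOSE v (myval P i) None)"

fun effect ::
  "('v, 'h) params \<Rightarrow> pid \<Rightarrow> ('v, 'h) pstate \<Rightarrow> ('v, 'h) trigger \<Rightarrow>
   ('v, 'h) pstate \<Rightarrow> ('v, 'h) action set \<Rightarrow> bool" where
  "effect P i s (LeaderTimeout v) s' out \<longleftrightarrow>
     s' = s \<and> (\<exists>m. leader_proposal P i s v m \<and> out = send_all P i m)"
| "effect P i s (ProposeReceived m) s' out \<longleftrightarrow>
     (\<exists>j v x C. m = (j, PROPOSE v x C) \<and>
        s' = s\<lparr>curr_val := Some x, voted := Some True\<rparr> \<and>
        out = send_all P i (PREPARED v (hash P x)))"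
| "effect P i s (PreparedQuorum Q v h) s' out \<longleftrightarrow>
     s' = s\<lparr>prepared_val := curr_val s, prepared_view := v, locked_view := v,
            cert := Some (prepared_cert Q v h)\<rparr> \<and>
     out = send_all P i (COMMITTED v h)"
| "effect P i s (CommittedQuorum Q v h) s' out \<longleftrightarrow>
     s' = s \<and> out = {Decide i x | x. curr_val s = Some x}"

definition run_handler ::
  "('v, 'h) params \<Rightarrow> pid \<Rightarrow> real \<Rightarrow> ('v, 'h) pstate \<Rightarrow> ('v, 'h) trigger \<Rightarrow>
   ('v, 'h) pstate \<Rightarrow> ('v, 'h) action set \<Rightarrow> bool" where
  "run_handler P i c s g s' out \<longleftrightarrow> enabled P i c s g \<and>
     (\<exists>s1. effect P i s g s1 out \<and> s' = s1\<lparr>handled := insert g (handled s1)\<rparr>)"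

subsection \<open>Executions\<close>

datatype ('v, 'h) event =
    Start pid
  | NewView pid view
  | Deliver pid pid "('v, 'h) smsg"
  | Handler pid "('v, 'h) trigger"
  | ByzantineSend pid pid "('v, 'h) smsg"

text \<open>
  A run is an infinite sequence of timed events. \<open>event R k\<close> happens at real time \<open>time R k\<close>,
  takes the local states \<open>state R k\<close> to \<open>state R (Suc k)\<close> and produces \<open>outputs R k\<close>;
  \<open>clock R i t\<close> is the reading of the local clock of \<open>i\<close> at real time \<open>t\<close>.
\<close>

record ('v, 'h) run =
  faulty :: "pid set"
  GST :: real
  delta :: real
  clock :: "pid \<Rightarrow> real \<Rightarrow> real"
  time :: "nat \<Rightarrow> real"
  event :: "nat \<Rightarrow> ('v, 'h) event"
  state :: "nat \<Rightarrow> pid \<Rightarrow> ('v, 'h) pstate"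
  outputs :: "nat \<Rightarrow> ('v, 'h) action set"

definition correct :: "('v, 'h) params \<Rightarrow> ('v, 'h) run \<Rightarrow> pid set" where
  "correct P R = procs P - faulty R"

definition sent_before :: "('v, 'h) run \<Rightarrow> nat \<Rightarrow> pid \<Rightarrow> pid \<Rightarrow> ('v, 'h) smsg \<Rightarrow> bool" where
  "sent_before R k i j m \<longleftrightarrow> (\<exists>k' < k. Send i j m \<in> outputs R k')"

text \<open>
  Unforgeability: a faulty process can put into a message only signatures of faulty processes
  and signed messages that a correct process has already sent to someone.
\<close>

definition unforged ::
  "('v, 'h) params \<Rightarrow> ('v, 'h) run \<Rightarrow> nat \<Rightarrow> ('v, 'h) smsg \<Rightarrow> bool" where
  "unforged P R k m \<longleftrightarrow> (\<forall>(j, m') \<in> signed_parts m.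
     j \<in> faulty R \<or> (j \<in> correct P R \<and> (\<exists>d. sent_before R k j d (j, m'))))"

text \<open>
  The step taken at index \<open>k\<close>. States of faulty processes are meaningless. The source of a
  packet is authentic; faulty processes may relay messages signed by others.
\<close>

fun step_ok :: "('v, 'h) params \<Rightarrow> ('v, 'h) run \<Rightarrow> nat \<Rightarrow> ('v, 'h) event \<Rightarrow> bool" where
  "step_ok P R k (Start i) \<longleftrightarrow>
     i \<in> correct P R \<and> state R (Suc k) = state R k \<and> outputs R k = {}"
| "step_ok P R k (NewView i v) \<longleftrightarrow>
     i \<in> correct P R \<and> 1 \<le> v \<and>
     state R (Suc k) = (state R k)(i := enter_view P i (clock R i (time R k)) v (state R k i)) \<and>
     outputs R k = enter_view_out P i v (state R k i)"
| "step_ok P R k (Deliver j i m) \<longleftrightarrow>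
     i \<in> correct P R \<and> sent_before R k j i m \<and>
     (\<exists>s'. receive (state R k i) m s' \<and> state R (Suc k) = (state R k)(i := s')) \<and>
     outputs R k = {}"
| "step_ok P R k (Handler i g) \<longleftrightarrow>
     i \<in> correct P R \<and>
     (\<exists>s'. run_handler P i (clock R i (time R k)) (state R k i) g s' (outputs R k) \<and>
           state R (Suc k) = (state R k)(i := s'))"
| "step_ok P R k (ByzantineSend j i m) \<longleftrightarrow>
     j \<in> faulty R \<and> i \<in> procs P \<and> unforged P R k m \<and>
     state R (Suc k) = state R k \<and> outputs R k = {Send j i m}"

definition steps_ok :: "('v, 'h) params \<Rightarrow> ('v, 'h) run \<Rightarrow> bool" where
  "steps_ok P R \<longleftrightarrow>
     (\<forall>i \<in> correct P R. state R 0 i = init_state) \<and> (\<forall>k. step_ok P R k (event R k))"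

definition time_ok :: "('v, 'h) run \<Rightarrow> bool" where
  "time_ok R \<longleftrightarrow> 0 \<le> time R 0 \<and> mono (time R) \<and> (\<forall>T. \<exists>k. T < time R k)"

text \<open>
  Local processing takes zero time: real time does not pass while a handler of a correct process
  can run.
\<close>

definition zero_time_processing :: "('v, 'h) params \<Rightarrow> ('v, 'h) run \<Rightarrow> bool" where
  "zero_time_processing P R \<longleftrightarrow>
     (\<forall>k t. time R k \<le> t \<and> t < time R (Suc k) \<longrightarrow>
        (\<forall>i \<in> correct P R. \<forall>g. \<not> enabled P i (clock R i t) (state R (Suc k) i) g))"

definition clocks_ok :: "('v, 'h) params \<Rightarrow> ('v, 'h) run \<Rightarrow> bool" where
  "clocks_ok P R \<longleftrightarrow> (\<forall>i \<in> correct P R. mono (clock R i) \<and>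
     (\<forall>s t. GST R \<le> s \<and> s \<le> t \<longrightarrow> clock R i t - clock R i s = t - s))"

definition delivery_ok :: "('v, 'h) params \<Rightarrow> ('v, 'h) run \<Rightarrow> bool" where
  "delivery_ok P R \<longleftrightarrow>
     (\<forall>i \<in> correct P R. \<forall>j \<in> correct P R. \<forall>m k.
        Send i j m \<in> outputs R k \<and> GST R \<le> time R k \<longrightarrow>
        (\<exists>k' > k. event R k' = Deliver i j m \<and> time R k' \<le> time R k + delta R)) \<and>
     (\<forall>i \<in> correct P R. \<forall>m k. Send i i m \<in> outputs R k \<longrightarrow> (\<exists>k' > k. event R k' = Deliver i i m))"

text \<open>A process enters a view at most once, so that the entry times below are well defined.\<close>

definition entries_unique :: "('v, 'h) run \<Rightarrow> bool" where
  "entries_unique R \<longleftrightarrow>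
     (\<forall>i v k k'. event R k = NewView i v \<and> event R k' = NewView i v \<longrightarrow> k = k')"

definition all_start :: "('v, 'h) params \<Rightarrow> ('v, 'h) run \<Rightarrow> bool" where
  "all_start P R \<longleftrightarrow> (\<forall>i \<in> correct P R. \<exists>k. event R k = Start i)"

definition params_ok :: "('v, 'h) params \<Rightarrow> ('v, 'h) run \<Rightarrow> bool" where
  "params_ok P R \<longleftrightarrow>
     faulty R \<subseteq> procs P \<and> card (faulty R) \<le> max_faulty P \<and>
     inj (hash P) \<and> (\<forall>i \<in> correct P R. valid P (myval P i)) \<and>
     (\<forall>v. 0 \<le> Fp P v) \<and> 0 \<le> delta R"

definition hotstuff_run :: "('v, 'h) params \<Rightarrow> ('v, 'h) run \<Rightarrow> bool" where
  "hotstuff_run P R \<longleftrightarrow>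
     params_ok P R \<and> steps_ok P R \<and> time_ok R \<and> zero_time_processing P R \<and>
     clocks_ok P R \<and> delivery_ok P R \<and> entries_unique R \<and> all_start P R"

definition decides_at ::
  "('v, 'h) run \<Rightarrow> pid \<Rightarrow> view \<Rightarrow> real \<Rightarrow> bool" where
  "decides_at R i v t \<longleftrightarrow>
     (\<exists>k x. Decide i x \<in> outputs R k \<and> curr_view (state R k i) = v \<and> time R k = t)"

subsection \<open>The synchronizer specification\<close>

definition enters :: "('v, 'h) run \<Rightarrow> pid \<Rightarrow> view \<Rightarrow> real \<Rightarrow> bool" where
  "enters R i v t \<longleftrightarrow> (\<exists>k. event R k = NewView i v \<and> time R k = t)"

definition entered :: "('v, 'h) run \<Rightarrow> pid \<Rightarrow> view \<Rightarrow> bool" where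
  "entered R i v \<longleftrightarrow> (\<exists>t. enters R i v t)"

definition E_proc :: "('v, 'h) run \<Rightarrow> pid \<Rightarrow> view \<Rightarrow> real" where
  "E_proc R i v = (THE t. enters R i v t)"

definition entry_times :: "('v, 'h) params \<Rightarrow> ('v, 'h) run \<Rightarrow> view \<Rightarrow> real set" where
  "entry_times P R v = {E_proc R i v | i. i \<in> correct P R \<and> entered R i v}"

definition E_first :: "('v, 'h) params \<Rightarrow> ('v, 'h) run \<Rightarrow> view \<Rightarrow> real" where
  "E_first P R v = Min (entry_times P R v)"

definition E_last :: "('v, 'h) params \<Rightarrow> ('v, 'h) run \<Rightarrow> view \<Rightarrow> real" where
  "E_last P R v = Max (entry_times P R v)"

definition timeout_function :: "(nat \<Rightarrow> real) \<Rightarrow> bool" where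
  "timeout_function F \<longleftrightarrow> mono F \<and> F 0 = 0 \<and> (\<forall>\<theta>. \<exists>v. \<forall>v' \<ge> v. F v' > \<theta>)"

text \<open>
  The specification for a view \<open>V\<close> and a bound \<open>d\<close>. \<open>E_first\<close> and \<open>E_last\<close> are used only for views
  from \<open>V\<close> on, which by the third conjunct every correct process enters.
\<close>

definition synchronizer_spec ::
  "('v, 'h) params \<Rightarrow> ('v, 'h) run \<Rightarrow> (nat \<Rightarrow> real) \<Rightarrow> view \<Rightarrow> real \<Rightarrow> bool" where
  "synchronizer_spec P R F V d \<longleftrightarrow>
     (\<forall>i \<in> correct P R. \<forall>v v'. v < v' \<and> entered R i v \<and> entered R i v' \<longrightarrow> E_proc R i v < E_proc R i v') \<and>
     E_first P R V \<ge> GST R \<and>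
     (\<forall>i \<in> correct P R. \<forall>v \<ge> V. entered R i v) \<and>
     (\<forall>v \<ge> V. E_last P R v \<le> E_first P R v + d) \<and>
     (\<forall>v \<ge> V. E_first P R (v + 1) \<ge> E_first P R v + F v)"

end

theory Submission
  imports Defs
begin

text \<open>
  From \<open>E_last(v)\<close> until \<open>E_last(v) + Fp(v) + 3\<delta>\<close> every correct process is in view \<open>v\<close>, since the next view
  is not entered before \<open>E_first(v) + F(v)\<close>. All \<open>NEWLEADER\<close> messages of correct processes reach the leader by
  \<open>E_last(v) + \<delta> \<le> E_first(v) + 3\<delta>\<close>, before its timer expires, so its proposal is justified by a certificate
  at least as high as the lock of any correct process. Two certificates for the same view agree by quorum
  intersection, hence every correct process accepts the proposal. Proposing, voting and committing then
  take one message delay \<open>\<delta>\<close> each. In view 1, where the leader does not wait, no correct process has a lock.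
\<close>

text \<open>Timely delivery alone does not make a message available: it may reach a process that has
  not yet entered the view, and the buffer keeps one message per signer and type. Most of the
  invariants below therefore serve retention: a correct process signs at most one message of each
  type per view, and nobody else can produce its signature. The second point needs care because
  faulty processes may relay signed messages and embed signatures in certificates, so authenticity
  is tracked for every signed part of a message, and certificates are followed through the local
  state. Progress is obtained without locating handlers in the event sequence: in the state reached
  when all events up to a time T have happened, zero-time processing leaves no handler enabled, so
  every trigger whose guard holds there has already been handled, and invariants about
  \<open>handled\<close> recover its effect.\<close>

definition authentic ::
  "('v, 'h) params \<Rightarrow> ('v, 'h) run \<Rightarrow> nat \<Rightarrow> ('v, 'h) smsg \<Rightarrow> bool" where
  "authentic P R k p \<longleftrightarrow>
     fst p \<in> faulty R \<or> (fst p \<in> correct P R \<and> (\<exists>d. sent_before R k (fst p) d p))"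

lemma unforged_iff_authentic: "unforged P R k m \<longleftrightarrow> (\<forall>p \<in> signed_parts m. authentic P R k p)"
  unfolding unforged_def authentic_def by fastforce

lemma sent_before_mono: "sent_before R k i d m \<Longrightarrow> k \<le> k' \<Longrightarrow> sent_before R k' i d m"
  unfolding sent_before_def by (meson less_le_trans)

lemma sent_before_Suc: "sent_before R (Suc k) i d m \<longleftrightarrow> sent_before R k i d m \<or> Send i d m \<in> outputs R k"
  unfolding sent_before_def by (auto simp: less_Suc_eq)

lemma authentic_mono: "authentic P R k p \<Longrightarrow> k \<le> k' \<Longrightarrow> authentic P R k' p"
  unfolding authentic_def using sent_before_mono by blast

lemma unforged_mono: "unforged P R k m \<Longrightarrow> k \<le> k' \<Longrightarrow> unforged P R k' m"
  unfolding unforged_iff_authentic using authentic_mono by blast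

lemma self_in_signed_parts: "m \<in> signed_parts m"
  by (cases m rule: signed_parts.cases) auto

lemma unforged_authentic: "unforged P R k m \<Longrightarrow> authentic P R k m"
  unfolding unforged_iff_authentic using self_in_signed_parts by blast

lemma send_in_send_all [simp]:
  "Send i d m \<in> send_all P j m' \<longleftrightarrow> i = j \<and> m = (j, m') \<and> d \<in> procs P"
  unfolding send_all_def send_to_def by auto

section \<open>Quorums and correct processes\<close>

lemma quorum_inter_correct:
  assumes Q: "quorum P Q" and Q': "quorum P Q'"
    and F: "faulty R \<subseteq> procs P" "card (faulty R) \<le> max_faulty P"
  shows "\<exists>j. j \<in> Q \<and> j \<in> Q' \<and> j \<in> correct P R"
proof (rule ccontr)
  assume none: "\<not> ?thesis"
  have fin: "finite (procs P)" by (simp add: procs_def)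
  have sub: "Q \<subseteq> procs P" "Q' \<subseteq> procs P" and c: "card Q = 2 * max_faulty P + 1" "card Q' = 2 * max_faulty P + 1"
    using Q Q' by (auto simp: quorum_def)
  have finQ: "finite Q" "finite Q'" using sub fin finite_subset by blast+
  have "Q \<inter> Q' \<subseteq> faulty R" using none sub unfolding correct_def by auto
  then have "card (Q \<inter> Q') \<le> max_faulty P"
    using F fin by (meson card_mono finite_subset le_trans)
  moreover have "card (Q \<union> Q') \<le> 3 * max_faulty P + 1"
    using card_mono[OF fin, of "Q \<union> Q'"] sub by (simp add: procs_def nprocs_def)
  moreover have "card Q + card Q' = card (Q \<union> Q') + card (Q \<inter> Q')"
    using finQ by (rule card_Un_Int)
  \<comment> \<open>With f = \<open>max_faulty P\<close>, two quorums have 4f+2 members counted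
    twice over a union of at most 3f+1, so they share at least f+1, more than the faulty
    ones.\<close>
  ultimately show False using c by linarith
qed

lemma correct_quorum:
  assumes F: "faulty R \<subseteq> procs P" "card (faulty R) \<le> max_faulty P"
  obtains Q where "quorum P Q" "Q \<subseteq> correct P R"
proof -
  have "card (correct P R) = card (procs P) - card (faulty R)"
    unfolding correct_def using F by (simp add: card_Diff_subset finite_subset procs_def)
  then have "2 * max_faulty P + 1 \<le> card (correct P R)"
    using F by (simp add: procs_def nprocs_def)
  then obtain Q where "Q \<subseteq> correct P R" "card Q = 2 * max_faulty P + 1"
    by (meson obtain_subset_with_card_n)
  moreover have "correct P R \<subseteq> procs P" by (auto simp: correct_def)
  ultimately show ?thesis using that unfolding quorum_def by blast
qed

section \<open>Single steps of one process\<close>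

fun trigger_view :: "('v, 'h) trigger \<Rightarrow> view" where
  "trigger_view (LeaderTimeout v) = v"
| "trigger_view (ProposeReceived m) = view_of (snd m)"
| "trigger_view (PreparedQuorum Q v h) = v"
| "trigger_view (CommittedQuorum Q v h) = v"

lemma guard_view: "guard P i c s g \<Longrightarrow> curr_view s = trigger_view g"
  by (cases g) auto

text \<open>The buffering rules reduced to what the local invariants need: nothing but
  \<open>m\<close> is added, and nothing for the current view is evicted, so a proposal that was
  voted for stays in \<open>received\<close> throughout its view.\<close>

lemma receive_cases:
  assumes "receive s m s'"
  obtains r where "s' = s\<lparr>received := r\<rparr>" "r \<subseteq> insert m (received s)"
    "\<And>p. p \<in> received s \<Longrightarrow> view_of (snd p) \<le> curr_view s \<Longrightarrow> p \<in> r"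
proof
  show "s' = s\<lparr>received := received s'\<rparr>" "received s' \<subseteq> insert m (received s)"
    using assms by (auto simp: receive_def Let_def split: if_splits)
  show "p \<in> received s'" if "p \<in> received s" "view_of (snd p) \<le> curr_view s" for p
    using assms that by (auto simp: receive_def Let_def buffered_same_slot_def split: if_splits)
qed

lemma effect_frame:
  "effect P i s g s1 out \<Longrightarrow> curr_view s1 = curr_view s \<and> timer s1 = timer s
     \<and> received s1 = received s \<and> handled s1 = handled s"
  by (cases g) auto

text \<open>A lock on the current view requires a vote in it, hence the strict inequality while
  \<open>voted\<close> is false. The clause for view 1 prevents its leader from proposing again by
  timeout. The last clause makes the process's own \<open>NEWLEADER\<close> message pass
  \<open>valid_new_leader\<close>.\<close>

definition wf_state :: "('v, 'h) params \<Rightarrow> ('v, 'h) pstate \<Rightarrow> bool" where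
  "wf_state P s \<longleftrightarrow>
     locked_view s = prepared_view s \<and> prepared_view s \<le> curr_view s \<and>
     (voted s = None \<longleftrightarrow> curr_view s = 0) \<and>
     (voted s = Some False \<longrightarrow> prepared_view s < curr_view s) \<and>
     (curr_view s = 1 \<longrightarrow> timer s = None) \<and>
     (prepared_view s \<noteq> 0 \<longrightarrow>
        (\<exists>x. prepared_val s = Some x \<and> prepared P (cert s) (prepared_view s) (hash P x)))"

lemma wf_state_effect:
  assumes "wf_state P s" "guard P i c s g" "effect P i s g s1 out"
  shows "wf_state P (s1\<lparr>handled := H\<rparr>)"
proof (cases g)
  case (LeaderTimeout v)
  then show ?thesis using assms by (simp add: wf_state_def)
next
  case (ProposeReceived m)
  then obtain x where "s1 = s\<lparr>curr_val := Some x, voted := Some True\<rparr>" "voted s = Some False"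
    using assms by auto
  then show ?thesis using assms(1) by (simp add: wf_state_def)
next
  case (PreparedQuorum Q v h)
  then have "prepared P (Some (prepared_cert Q v h)) v h" using assms(2) by (auto simp: prepared_def)
  moreover obtain x where "curr_val s = Some x" "h = hash P x" "curr_view s = v" "voted s = Some True"
    using PreparedQuorum assms(2) by auto
  ultimately show ?thesis using PreparedQuorum assms(1,3) by (simp add: wf_state_def)
next
  case (CommittedQuorum Q v h)
  then show ?thesis using assms by (simp add: wf_state_def)
qed

lemma send_effect:
  assumes "effect P i s g s1 out" "guard P i c s g" "Send j d p \<in> out"
  shows "j = i" "fst p = i" "view_of (snd p) = curr_view s"
  using assms by (cases g; auto simp: leader_proposal_def Let_def split: if_splits)+

lemma send_enter_view:
  assumes "Send j d p \<in> enter_view_out P i v s"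
  shows "p = (i, NEWLEADER v (prepared_view s) (prepared_val s) (cert s)) \<and> d = leader P v \<or>
     p = (i, PROPOSE v (myval P i) None) \<and> v = 1 \<and> i = leader P 1 \<and> d \<in> procs P"
  using assms by (simp add: enter_view_out_def send_to_def split: if_splits) blast

text \<open>Every entry of \<open>M\<close> has a view below \<open>w\<close>, so the fallback proposal is made only if all of them are 0.\<close>

lemma leader_proposal_cases:
  assumes "leader_proposal P i s w (PROPOSE w x C)"
  shows "(x = myval P i \<and> C = None \<and> (\<forall>(j, u, y, D) \<in> new_leader_msgs P s w. u = 0)) \<or>
    (\<exists>j u. (j, u, Some x, C) \<in> new_leader_msgs P s w \<and> u \<noteq> 0 \<and>
       (\<forall>(j', u', y', C') \<in> new_leader_msgs P s w. u' \<le> u))"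
proof -
  let ?M = "new_leader_msgs P s w"
  let ?best = "\<lambda>(j, u, y, C). u \<noteq> 0 \<and> (\<forall>(j', u', y', C') \<in> ?M. u' \<le> u)"
  show ?thesis
  proof (cases "\<exists>q \<in> ?M. ?best q")
    case True
    then have "\<exists>j u x' C'. (j, u, Some x', C') \<in> ?M \<and> ?best (j, u, Some x', C') \<and>
        PROPOSE w x C = PROPOSE w x' C'"
      using assms unfolding leader_proposal_def Let_def by (simp only: if_True)
    then show ?thesis by auto
  next
    case False
    then have "PROPOSE w x C = PROPOSE w (myval P i) None"
      using assms unfolding leader_proposal_def Let_def by (simp only: if_False)
    moreover have "u = 0" if q: "(j, u, y, D) \<in> ?M" for j u y D
    proof (rule ccontr)
      assume "u \<noteq> 0"
      have "\<forall>q. q \<in> ?M \<longrightarrow> fst (snd q) < w" by (auto simp: new_leader_msgs_def)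
      then obtain q' where q': "q' \<in> ?M" "\<forall>q. q \<in> ?M \<longrightarrow> fst (snd q) \<le> fst (snd q')"
        using ex_has_greatest_nat[of "\<lambda>q. q \<in> ?M" "(j, u, y, D)" "\<lambda>q. fst (snd q)" w] q by blast
      then have "?best q'" using q \<open>u \<noteq> 0\<close> by (cases q') fastforce
      then show False using False q' by blast
    qed
    ultimately show ?thesis by auto
  qed
qed

section \<open>Runs and the order of view entries\<close>

locale hotstuff =
  fixes P :: "('v, 'h) params" and R :: "('v, 'h) run"
  assumes run: "hotstuff_run P R"
    and entries_increase: "\<And>i v v'. \<lbrakk>i \<in> correct P R; v < v'; entered R i v; entered R i v'\<rbrakk>
      \<Longrightarrow> E_proc R i v < E_proc R i v'"
begin

lemma params: "params_ok P R" and steps: "steps_ok P R" and times: "time_ok R"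
  and zero_time: "zero_time_processing P R" and clocks: "clocks_ok P R"
  and delivery: "delivery_ok P R" and unique: "entries_unique R"
  using run by (auto simp: hotstuff_run_def)

lemma step: "step_ok P R k (event R k)"
  using steps by (simp add: steps_ok_def)

lemma time_mono: "k \<le> k' \<Longrightarrow> time R k \<le> time R k'"
  using times by (auto simp: time_ok_def mono_def)

lemma inj_hash: "hash P x = hash P y \<Longrightarrow> x = y"
  using params by (auto simp: params_ok_def inj_def)

lemma faulty_bound: "faulty R \<subseteq> procs P" "card (faulty R) \<le> max_faulty P"
  using params by (auto simp: params_ok_def)

lemma correct_in_procs: "i \<in> correct P R \<Longrightarrow> i \<in> procs P"
  by (simp add: correct_def)

lemma E_proc_eq: "event R k = NewView i v \<Longrightarrow> E_proc R i v = time R k"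
  unfolding E_proc_def enters_def using unique unfolding entries_unique_def
  by (intro the_equality) blast+

lemma enteredI: "event R k = NewView i v \<Longrightarrow> entered R i v"
  unfolding entered_def enters_def by blast

text \<open>The global step as seen by one fixed correct process. The case \<open>idle\<close>
  absorbs the steps of all others: they leave its state alone and cannot send with \<open>i\<close>
  as source.\<close>

lemma step_cases [consumes 1, case_names idle new_view deliver handler]:
  assumes "i \<in> correct P R"
  obtains
    (idle) "state R (Suc k) i = state R k i" "\<And>d m. Send i d m \<notin> outputs R k"
  | (new_view) v where "event R k = NewView i v" "1 \<le> v"
      "state R (Suc k) i = enter_view P i (clock R i (time R k)) v (state R k i)"
      "outputs R k = enter_view_out P i v (state R k i)"
  | (deliver) j m r where "event R k = Deliver j i m" "sent_before R k j i m"
      "receive (state R k i) m (state R (Suc k) i)" "outputs R k = {}"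
      "state R (Suc k) i = state R k i\<lparr>received := r\<rparr>" "r \<subseteq> insert m (received (state R k i))"
      "\<And>p. p \<in> received (state R k i) \<Longrightarrow> view_of (snd p) \<le> curr_view (state R k i) \<Longrightarrow> p \<in> r"
  | (handler) g s1 where "event R k = Handler i g"
      "enabled P i (clock R i (time R k)) (state R k i) g"
      "effect P i (state R k i) g s1 (outputs R k)"
      "state R (Suc k) i = s1\<lparr>handled := insert g (handled s1)\<rparr>"
proof (cases "event R k")
  case (Start j)
  then show ?thesis using step[of k] idle by auto
next
  case (NewView j v)
  then show ?thesis using step[of k] idle new_view
    by (cases "j = i") (auto simp: enter_view_out_def send_to_def)
next
  case (Deliver j l m)
  show ?thesis
  proof (cases "l = i")
    case True
    then have *: "sent_before R k j i m" "receive (state R k i) m (state R (Suc k) i)" "outputs R k = {}"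
      using step[of k] Deliver by auto
    obtain r where "state R (Suc k) i = state R k i\<lparr>received := r\<rparr>"
      "r \<subseteq> insert m (received (state R k i))"
      "\<And>p. p \<in> received (state R k i) \<Longrightarrow> view_of (snd p) \<le> curr_view (state R k i) \<Longrightarrow> p \<in> r"
      using receive_cases[OF *(2)] by metis
    then show ?thesis using deliver * Deliver True by blast
  next
    case False
    then show ?thesis using step[of k] Deliver idle by auto
  qed
next
  case (Handler j g)
  show ?thesis
  proof (cases "j = i")
    case True
    then show ?thesis using step[of k] Handler handler by (auto simp: run_handler_def)
  next
    case False
    then have "state R (Suc k) i = state R k i" using step[of k] Handler by auto
    moreover have "Send i d m \<notin> outputs R k" for d m
      using step[of k] Handler False by (cases g) (auto simp: run_handler_def)
    ultimately show ?thesis using idle by blast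
  qed
next
  case (ByzantineSend j l m)
  then show ?thesis using step[of k] idle assms by (auto simp: correct_def)
qed

lemma curr_view_entered:
  assumes i: "i \<in> correct P R" and "curr_view (state R k i) \<noteq> 0"
  shows "\<exists>k' < k. event R k' = NewView i (curr_view (state R k i))"
  using assms(2)
proof (induction k)
  case 0
  then show ?case using steps i by (simp add: steps_ok_def init_state_def)
next
  case (Suc k)
  from i show ?case
  proof (cases rule: step_cases[where k = k])
    case idle
    then show ?thesis using Suc by (metis less_SucI)
  next
    case (new_view v)
    then show ?thesis by (auto simp: enter_view_def)
  next
    case (deliver j m r)
    then have "curr_view (state R (Suc k) i) = curr_view (state R k i)"
      by simp
    then show ?thesis using Suc by (metis less_SucI)
  next
    case (handler g s1)
    then have "curr_view (state R (Suc k) i) = curr_view (state R k i)"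
      using effect_frame[OF handler(3)] by simp
    then show ?thesis using Suc by (metis less_SucI)
  qed
qed

text \<open>Property (P1) compares times, while the invariants need the order of events. A later
  event entering a smaller view would by (P1) have a strictly smaller time, against monotonicity of
  time; equal views are excluded by \<open>entries_unique\<close>.\<close>

lemma entry_order:
  assumes "i \<in> correct P R" "event R k = NewView i v" "event R k' = NewView i v'" "k < k'"
  shows "v < v'"
proof (rule ccontr)
  assume "\<not> v < v'"
  moreover have "v \<noteq> v'"
    using unique assms unfolding entries_unique_def by (metis less_irrefl)
  ultimately have "E_proc R i v' < E_proc R i v"
    using entries_increase assms enteredI by (meson linorder_neqE_nat)
  then show False using E_proc_eq assms time_mono[of k k'] by simp
qed

lemma new_view_greater:
  assumes "i \<in> correct P R" "event R k = NewView i v"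
  shows "curr_view (state R k i) < v"
proof (cases "curr_view (state R k i) = 0")
  case True
  then show ?thesis using step[of k] assms by simp
next
  case False
  then show ?thesis using curr_view_entered entry_order assms by blast
qed

lemma curr_view_Suc:
  assumes i: "i \<in> correct P R"
  shows "curr_view (state R k i) \<le> curr_view (state R (Suc k) i)"
  using i
proof (cases rule: step_cases[where k = k])
  case (new_view v)
  then show ?thesis using new_view_greater[OF i new_view(1)] by (simp add: enter_view_def)
next
  case (deliver j m r)
  then show ?thesis by simp
next
  case (handler g s1)
  then show ?thesis using effect_frame[OF handler(3)] by simp
qed simp

lemma curr_view_mono:
  assumes "i \<in> correct P R" "k \<le> k'"
  shows "curr_view (state R k i) \<le> curr_view (state R k' i)"
  by (rule lift_Suc_mono_le[where f = "\<lambda>k. curr_view (state R k i)"]) (use assms curr_view_Suc in auto)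

section \<open>Invariants of a correct process\<close>

definition sent :: "nat \<Rightarrow> pid \<Rightarrow> ('v, 'h) msg \<Rightarrow> bool" where
  "sent k i m \<longleftrightarrow> (\<forall>d \<in> procs P. sent_before R k i d (i, m))"

lemma sent_Suc: "sent k i m \<Longrightarrow> sent (Suc k) i m"
  unfolding sent_def by (simp add: sent_before_Suc)

text \<open>The induction scheme for local invariants. The \<open>new_view\<close> case already
  supplies that the view strictly grows, which is how (P1) enters these proofs.\<close>

lemma run_induct [consumes 1, case_names init idle new_view deliver handler]:
  assumes i: "i \<in> correct P R"
    and init: "state R 0 i = init_state \<Longrightarrow> Q 0"
    and idle: "\<And>k. \<lbrakk>Q k; state R (Suc k) i = state R k i; \<And>d m. Send i d m \<notin> outputs R k\<rbrakk> \<Longrightarrow> Q (Suc k)"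
    and new_view: "\<And>k v. \<lbrakk>Q k; event R k = NewView i v; 1 \<le> v; curr_view (state R k i) < v;
      state R (Suc k) i = enter_view P i (clock R i (time R k)) v (state R k i);
      outputs R k = enter_view_out P i v (state R k i)\<rbrakk> \<Longrightarrow> Q (Suc k)"
    and deliver: "\<And>k j m r. \<lbrakk>Q k; state R (Suc k) i = state R k i\<lparr>received := r\<rparr>;
      sent_before R k j i m; r \<subseteq> insert m (received (state R k i));
      \<And>p. p \<in> received (state R k i) \<Longrightarrow> view_of (snd p) \<le> curr_view (state R k i) \<Longrightarrow> p \<in> r;
      outputs R k = {}\<rbrakk> \<Longrightarrow> Q (Suc k)"
    and handler: "\<And>k g s. \<lbrakk>Q k; event R k = Handler i g;
      guard P i (clock R i (time R k)) (state R k i) g; g \<notin> handled (state R k i);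
      effect P i (state R k i) g s (outputs R k);
      state R (Suc k) i = s\<lparr>handled := insert g (handled s)\<rparr>\<rbrakk> \<Longrightarrow> Q (Suc k)"
  shows "Q k"
proof (induction k)
  case 0
  then show ?case using steps i init by (simp add: steps_ok_def)
next
  case (Suc k)
  from i show ?case
  proof (cases rule: step_cases[where k = k])
    case idle
    then show ?thesis using assms(3) Suc by simp
  next
    case (new_view v)
    then show ?thesis using assms(4)[OF Suc] new_view_greater[OF i] by simp
  next
    case (deliver j m r)
    then show ?thesis using assms(5)[OF Suc] by simp
  next
    case (handler g s1)
    then show ?thesis using assms(6)[OF Suc] by (simp add: enabled_def)
  qed
qed

lemma wf_reachable: "i \<in> correct P R \<Longrightarrow> wf_state P (state R k i)"
proof (induction k rule: run_induct)
  case (new_view k v)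
  then show ?case by (auto simp: wf_state_def enter_view_def)
next
  case (handler k g s)
  then show ?case using wf_state_effect[OF handler(1,3,5)] by simp
qed (auto simp: wf_state_def init_state_def)

lemma send_view:
  assumes i: "i \<in> correct P R" and "Send i d p \<in> outputs R k"
  shows "fst p = i \<and> view_of (snd p) = curr_view (state R (Suc k) i)"
  using i
proof (cases rule: step_cases[where k = k])
  case idle
  then show ?thesis using assms by blast
next
  case (new_view v)
  then have "fst p = i" "view_of (snd p) = v"
    using send_enter_view[of i d p P i v "state R k i"] assms(2) by auto
  then show ?thesis using new_view(3) by (simp add: enter_view_def)
next
  case (deliver j m r)
  then show ?thesis using assms by simp
next
  case (handler g s1)
  then show ?thesis
    using send_effect[OF handler(3) _ assms(2)] effect_frame[OF handler(3)]
    by (auto simp: enabled_def)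
qed

lemma sent_before_view:
  assumes i: "i \<in> correct P R" and "sent_before R k i d p"
  shows "fst p = i" "view_of (snd p) \<le> curr_view (state R k i)"
proof -
  obtain k' where "k' < k" "Send i d p \<in> outputs R k'"
    using assms unfolding sent_before_def by blast
  then show "fst p = i" "view_of (snd p) \<le> curr_view (state R k i)"
    using send_view[OF i] curr_view_mono[OF i, of "Suc k'" k] by fastforce+
qed

text \<open>Becoming prepared requires a vote first. So as long as the process has not voted, what
  it reported to the leader on entry is still its prepared state, and the leader has been told about
  the present lock.\<close>

lemma newleader_sent:
  assumes "i \<in> correct P R" "voted (state R k i) = Some False"
  shows "\<exists>k' < k. Send i (leader P (curr_view (state R k i)))
     (i, NEWLEADER (curr_view (state R k i)) (prepared_view (state R k i))
         (prepared_val (state R k i)) (cert (state R k i))) \<in> outputs R k'"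
proof -
  have "voted (state R k i) = Some False \<longrightarrow> (
     sent_before R k i (leader P (curr_view (state R k i)))
     (i, NEWLEADER (curr_view (state R k i)) (prepared_view (state R k i))
         (prepared_val (state R k i)) (cert (state R k i))))"
    using assms(1)
  proof (induction k rule: run_induct)
    case (handler k g s)
    then show ?case by (cases g) (auto simp: sent_before_Suc)
  qed (simp_all add: init_state_def sent_before_Suc enter_view_def enter_view_out_def send_to_def)
  then show ?thesis using assms(2) unfolding sent_before_def by blast
qed

lemma voted_proposal:
  assumes "i \<in> correct P R" "voted (state R k i) = Some True"
  shows "\<exists>x C. curr_val (state R k i) = Some x \<and> valid P x \<and>
    sent k i (PREPARED (curr_view (state R k i)) (hash P x)) \<and>
    (leader P (curr_view (state R k i)), PROPOSE (curr_view (state R k i)) x C) \<in> received (state R k i)"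
  using assms
proof (induction k rule: run_induct)
  case (handler k g s)
  show ?case
  proof (cases g)
    case (ProposeReceived m)
    then show ?thesis using handler by (cases m) (auto simp: sent_def sent_before_Suc)
  qed (use handler in \<open>auto simp: sent_Suc\<close>)
next
  case (deliver k j m r)
  then show ?case using sent_Suc by fastforce
qed (auto simp: init_state_def enter_view_def intro: sent_Suc)

text \<open>The view bound shows that a newly entered view starts with none of its own triggers
  handled; the second part leads from the history variable back to an event.\<close>

lemma handled_event:
  assumes "i \<in> correct P R" "g \<in> handled (state R k i)"
  shows "trigger_view g \<le> curr_view (state R k i)" "\<exists>k' < k. event R k' = Handler i g"
proof -
  have "g \<in> handled (state R k i) \<longrightarrow> trigger_view g \<le> curr_view (state R k i) \<and> (\<exists>k' < k. event R k' = Handler i g)"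
    using assms(1)
  proof (induction k rule: run_induct)
    case (handler k g' s)
    then show ?case using effect_frame[OF handler(5)] guard_view[OF handler(3)] less_Suc_eq by auto
  qed (auto simp: init_state_def enter_view_def less_Suc_eq)
  then show "trigger_view g \<le> curr_view (state R k i)" "\<exists>k' < k. event R k' = Handler i g"
    using assms(2) by auto
qed

text \<open>Within a view a vote is never retracted, and on entering a view no proposal for it has
  been handled yet. The same argument gives the effect of a handled \<open>PreparedQuorum\<close> in
  the next-but-none lemma on locks, since a lock changes only by such a handler.\<close>

lemma handled_propose_voted:
  assumes i: "i \<in> correct P R" and "ProposeReceived m \<in> handled (state R k i)" "view_of (snd m) = curr_view (state R k i)"
  shows "voted (state R k i) = Some True"
proof -
  have "ProposeReceived m \<in> handled (state R k i) \<longrightarrow> view_of (snd m) = curr_view (state R k i) \<longrightarrow>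
    voted (state R k i) = Some True"
    using i
  proof (induction k rule: run_induct)
    case (handler k g s)
    then show ?case by (cases g) auto
  next
    case (new_view k v)
    then show ?case using handled_event(1)[OF i, of "ProposeReceived m"] by (fastforce simp: enter_view_def)
  qed (auto simp: init_state_def)
  then show ?thesis using assms by blast
qed

lemma handled_prepared:
  assumes i: "i \<in> correct P R" and "PreparedQuorum Q (curr_view (state R k i)) h \<in> handled (state R k i)"
  shows "locked_view (state R k i) = curr_view (state R k i) \<and> sent k i (COMMITTED (curr_view (state R k i)) h)"
proof -
  have "PreparedQuorum Q (curr_view (state R k i)) h \<in> handled (state R k i) \<longrightarrow>
    locked_view (state R k i) = curr_view (state R k i) \<and> sent k i (COMMITTED (curr_view (state R k i)) h)"
    using i
  proof (induction k rule: run_induct)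
    case (handler k g s)
    then show ?case by (cases g) (auto simp: sent_def sent_before_Suc)
  next
    case (new_view k v)
    then show ?case using handled_event(1)[OF i, of "PreparedQuorum Q v h"] by (fastforce simp: enter_view_def)
  qed (auto simp: init_state_def sent_Suc)
  then show ?thesis using assms by blast
qed

text \<open>A vote fixes \<open>curr_val\<close> for the rest of the view, because accepting a
  proposal requires \<open>voted = Some False\<close>. On entry the claim is vacuous: everything
  sent so far belongs to lower views.\<close>

lemma prepared_sent_voted:
  assumes i: "i \<in> correct P R" and "sent_before R k i d (i, PREPARED (curr_view (state R k i)) h)"
  shows "voted (state R k i) = Some True \<and> map_option (hash P) (curr_val (state R k i)) = Some h"
proof -
  have "sent_before R k i d (i, PREPARED (curr_view (state R k i)) h) \<longrightarrow>
     voted (state R k i) = Some True \<and> map_option (hash P) (curr_val (state R k i)) = Some h"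
    using i
  proof (induction k rule: run_induct)
    case (handler k g s)
    then show ?case 
      by (cases g) (auto simp: sent_before_Suc leader_proposal_def Let_def split: if_splits)
  next
    case (new_view k v)
    have "Send i d (i, PREPARED v h) \<notin> outputs R k"
      using send_enter_view[of i d "(i, PREPARED v h)" P i v "state R k i"] new_view(6) by auto
    moreover have "\<not> sent_before R k i d (i, PREPARED v h)"
      using sent_before_view(2)[OF i, of k d "(i, PREPARED v h)"] new_view(4) by auto
    moreover have "curr_view (state R (Suc k) i) = v" using new_view(5) by (simp add: enter_view_def)
    ultimately show ?case by (simp add: sent_before_Suc)
  next
    case init
    then show ?case by (simp add: sent_before_def)
  qed (simp_all add: sent_before_Suc)
  then show ?thesis using assms by blast
qed

section \<open>A correct process does not equivocate\<close>

lemma prepared_output: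
  assumes i: "i \<in> correct P R" and "Send i d (i, PREPARED w h) \<in> outputs R k"
  shows "curr_view (state R k i) = w \<and> voted (state R k i) = Some False \<and>
    (\<exists>x. valid P x \<and> h = hash P x \<and> (\<forall>d h'. Send i d (i, PREPARED w h') \<in> outputs R k \<longrightarrow> h' = h))"
  using i
proof (cases rule: step_cases[where k = k])
  case (new_view v)
  then show ?thesis using assms(2) send_enter_view[of i d "(i, PREPARED w h)" P i v "state R k i"] by auto
next
  case (handler g s)
  then show ?thesis using assms(2)
  proof (cases g)
    case (ProposeReceived m)
    then show ?thesis using handler assms(2) by (cases m) (auto simp: enabled_def)
  qed (auto simp: leader_proposal_def Let_def split: if_splits)
qed (use assms in auto)

text \<open>Voting needs \<open>voted = Some False\<close>, whereas an earlier vote in the same view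
  leaves it true; so both sends come from one step, which signs a single hash.\<close>

lemma prepared_unique:
  assumes i: "i \<in> correct P R" and "Send i d (i, PREPARED w h) \<in> outputs R k"
    "Send i d' (i, PREPARED w h') \<in> outputs R k'"
  shows "h = h'"
proof -
  have no: False if "k < k'" "Send i d (i, PREPARED w h) \<in> outputs R k"
    "Send i d' (i, PREPARED w h') \<in> outputs R k'" for k k' d d' h h'
  proof -
    have "sent_before R k' i d (i, PREPARED w h)" using that unfolding sent_before_def by blast
    then show False using prepared_sent_voted[OF i, of k' d h] prepared_output[OF i that(3)] by simp
  qed
  have "k = k'" using no assms by (meson linorder_neqE_nat)
  then show ?thesis using prepared_output[OF i assms(2)] assms(3) by blast
qed

text \<open>Reduces uniqueness of \<open>COMMITTED\<close> messages to that of votes.\<close>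

lemma committed_output:
  assumes i: "i \<in> correct P R" and "Send i d (i, COMMITTED w h) \<in> outputs R k"
  shows "\<exists>k' < k. Send i d (i, PREPARED w h) \<in> outputs R k'"
  using i
proof (cases rule: step_cases[where k = k])
  case (new_view v)
  then show ?thesis using assms(2) send_enter_view[of i d "(i, COMMITTED w h)" P i v "state R k i"] by auto
next
  case (handler g s)
  then show ?thesis using assms(2)
  proof (cases g)
    case (PreparedQuorum Q v' h')
    then have "voted (state R k i) = Some True" "curr_view (state R k i) = w"
      "map_option (hash P) (curr_val (state R k i)) = Some h" "d \<in> procs P"
      using handler assms(2) by (auto simp: enabled_def)
    then show ?thesis using voted_proposal[OF i, of k] by (auto simp: sent_def sent_before_def)
  qed (auto simp: leader_proposal_def Let_def split: if_splits)
qed (use assms in auto)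

lemma newleader_output:
  assumes i: "i \<in> correct P R" and "Send i d (i, NEWLEADER w pv pval C) \<in> outputs R k"
  shows "event R k = NewView i w \<and> d = leader P w \<and> pv = prepared_view (state R k i) \<and>
    pval = prepared_val (state R k i) \<and> C = cert (state R k i)"
  using i
proof (cases rule: step_cases[where k = k])
  case (new_view v)
  then show ?thesis
    using assms(2) send_enter_view[of i d "(i, NEWLEADER w pv pval C)" P i v "state R k i"] by auto
next
  case (handler g s)
  then show ?thesis using assms(2)
    by (cases g) (auto simp: leader_proposal_def Let_def split: if_splits)
qed (use assms in auto)

lemma timer_view_1: "i \<in> correct P R \<Longrightarrow> curr_view (state R k i) = 1 \<Longrightarrow> timer (state R k i) = None"
  using wf_reachable unfolding wf_state_def by blast

text \<open>The two ways of proposing exclude each other: in view 1 the timer is never set, so the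
  timeout case has \<open>w \<noteq> 1\<close>.\<close>

lemma propose_output:
  assumes i: "i \<in> correct P R" and "Send i d (i, PROPOSE w x C) \<in> outputs R k"
  shows "i = leader P w \<and>
    (event R k = NewView i 1 \<and> w = 1 \<and> x = myval P i \<and> C = None \<or>
     event R k = Handler i (LeaderTimeout w) \<and> w \<noteq> 1 \<and> LeaderTimeout w \<notin> handled (state R k i) \<and>
     leader_proposal P i (state R k i) w (PROPOSE w x C) \<and> outputs R k = send_all P i (PROPOSE w x C))"
  using i
proof (cases rule: step_cases[where k = k])
  case (new_view v)
  then show ?thesis
    using assms(2) send_enter_view[of i d "(i, PROPOSE w x C)" P i v "state R k i"] by auto
next
  case (handler g s)
  then show ?thesis using assms(2)
  proof (cases g)
    case (LeaderTimeout v)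
    then obtain m where m: "leader_proposal P i (state R k i) v m" "outputs R k = send_all P i m"
      using handler by auto
    then have "m = PROPOSE w x C" "v = w"
      using assms(2) by (auto simp: leader_proposal_def Let_def split: if_splits)
    then show ?thesis using m LeaderTimeout handler timer_view_1[OF i, of k] by (auto simp: enabled_def)
  qed auto
qed (use assms in auto)

lemma handled_mono:
  assumes i: "i \<in> correct P R" and "k \<le> k'"
  shows "handled (state R k i) \<subseteq> handled (state R k' i)"
proof (rule lift_Suc_mono_le[OF _ assms(2)])
  fix k
  from i show "handled (state R k i) \<subseteq> handled (state R (Suc k) i)"
  proof (cases rule: step_cases[where k = k])
    case (new_view v)
    then show ?thesis by (simp add: enter_view_def)
  next
    case (handler g s)
    then show ?thesis using effect_frame[OF handler(3)] by auto
  qed simp_all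
qed

lemma handler_event:
  assumes "event R k = Handler i g"
  shows "i \<in> correct P R" "guard P i (clock R i (time R k)) (state R k i) g" "g \<notin> handled (state R k i)"
    "g \<in> handled (state R (Suc k) i)" "\<exists>s. effect P i (state R k i) g s (outputs R k)"
  using step[of k] assms by (auto simp: run_handler_def enabled_def)

lemma handler_unique:
  assumes "event R k = Handler i g" "event R k' = Handler i g"
  shows "k = k'"
proof -
  have False if "k < k'" "event R k = Handler i g" "event R k' = Handler i g" for k k'
    using handler_event[OF that(2)] handler_event[OF that(3)] handled_mono[of i "Suc k" k'] that(1) by auto
  then show ?thesis using assms by (meson linorder_neqE_nat)
qed

text \<open>Each type has its own reason: \<open>NEWLEADER\<close> is sent on the only entry into
  the view, \<open>PROPOSE\<close> on that entry or by a handler that runs once,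
  \<open>PREPARED\<close> by the only vote, and \<open>COMMITTED\<close> repeats the hash of that
  vote.\<close>

lemma message_unique:
  assumes i: "i \<in> correct P R" and m: "Send i d (i, m) \<in> outputs R k" and m': "Send i d' (i, m') \<in> outputs R k'"
    and eq: "type_of m = type_of m'" "view_of m = view_of m'"
  shows "m = m'"
proof (cases m)
  case (NEWLEADER w pv y C)
  then obtain pv' y' C' where m'_eq: "m' = NEWLEADER w pv' y' C'" using eq by (cases m') auto
  have *: "event R k = NewView i w" "event R k' = NewView i w"
    using newleader_output[OF i] m m' NEWLEADER m'_eq by blast+
  then have "k = k'" using unique unfolding entries_unique_def by blast
  then show ?thesis
    using newleader_output[OF i m[unfolded NEWLEADER]] newleader_output[OF i m'[unfolded m'_eq]] NEWLEADER m'_eq by simp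
next
  case (PROPOSE w x C)
  then obtain x' C' where m'_eq: "m' = PROPOSE w x' C'" using eq by (cases m') auto
  note out = propose_output[OF i m[unfolded PROPOSE]] propose_output[OF i m'[unfolded m'_eq]]
  show ?thesis
  proof (cases "w = 1")
    case True
    then show ?thesis using out PROPOSE m'_eq by simp
  next
    case False
    then have "k = k'" using out handler_unique by blast
    moreover have "outputs R k = send_all P i (PROPOSE w x C)" using out(1) False by blast
    ultimately show ?thesis using m' PROPOSE by simp
  qed
next
  case (PREPARED w h)
  then obtain h' where "m' = PREPARED w h'" using eq by (cases m') auto
  then show ?thesis using prepared_unique[OF i] m m' PREPARED by blast
next
  case (COMMITTED w h)
  then obtain h' where m'_eq: "m' = COMMITTED w h'" using eq by (cases m') auto
  have "h = h'"
    using committed_output[OF i m[unfolded COMMITTED]] committed_output[OF i m'[unfolded m'_eq]]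
      prepared_unique[OF i] by blast
  then show ?thesis using COMMITTED m'_eq by simp
qed

section \<open>Unforgeability along a run\<close>

lemma send_origin:
  assumes "Send j d m \<in> outputs R k"
  shows "j \<in> correct P R \<or> unforged P R k m"
proof (cases "event R k")
  case (Start i)
  then show ?thesis using step[of k] assms by simp
next
  case (NewView i v)
  then show ?thesis using step[of k] assms send_enter_view[of j d m P i v "state R k i"]
    by (auto simp: enter_view_out_def send_to_def split: if_splits)
next
  case (Deliver i l p)
  then show ?thesis using step[of k] assms by simp
next
  case (Handler i g)
  then show ?thesis
    using handler_event[OF Handler] send_effect(1)[of P i "state R k i" g _ "outputs R k"] assms by blast
next
  case (ByzantineSend i l p)
  then show ?thesis using step[of k] assms by simp
qed

text \<open>The only foreign signatures in a message of a correct process sit in a certificate, and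
  that is copied from its variable \<open>cert\<close> or, in a proposal, from a received
  \<open>NEWLEADER\<close> message.\<close>

lemma output_unforged:
  assumes i: "i \<in> correct P R" and m: "Send i d m \<in> outputs R k"
    and rec: "\<And>m. m \<in> received (state R k i) \<Longrightarrow> unforged P R k m"
    and crt: "\<And>p. p \<in> cert_parts (cert (state R k i)) \<Longrightarrow> authentic P R k p"
  shows "unforged P R (Suc k) m"
proof -
  have fst_m: "fst m = i" using send_view[OF i m] by simp
  have self: "authentic P R (Suc k) m"
    unfolding authentic_def sent_before_Suc fst_m using i m by blast
  have parts: "authentic P R (Suc k) p" if "p \<in> cert_parts C"
    and C: "\<And>p. p \<in> cert_parts C \<Longrightarrow> authentic P R k p" for p C
    using that authentic_mono[of P R k p "Suc k"] by simp
  obtain b where mb: "m = (i, b)" using fst_m by (cases m) auto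
  show ?thesis
  proof (cases b)
    case (NEWLEADER w pv y C)
    have "C = cert (state R k i)" using newleader_output[OF i m[unfolded mb NEWLEADER]] by blast
    then show ?thesis using self parts crt mb NEWLEADER unfolding unforged_iff_authentic by auto
  next
    case (PROPOSE w x C)
    have "authentic P R k p" if p: "p \<in> cert_parts C" for p
    proof -
      have "C \<noteq> None" using p by (auto simp: cert_parts_def)
      then have "leader_proposal P i (state R k i) w (PROPOSE w x C)"
        using propose_output[OF i m[unfolded mb PROPOSE]] by blast
      then obtain l w' where "(l, NEWLEADER w w' (Some x) C) \<in> received (state R k i)"
        using \<open>C \<noteq> None\<close> by (auto simp: leader_proposal_def Let_def new_leader_msgs_def split: if_splits)
      then have "unforged P R k (l, NEWLEADER w w' (Some x) C)" by (rule rec)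
      then show ?thesis using p unfolding unforged_iff_authentic by simp
    qed
    then show ?thesis using self parts mb PROPOSE unfolding unforged_iff_authentic by auto
  qed (use self mb in \<open>auto simp: unforged_iff_authentic\<close>)
qed

text \<open>The claims depend on each other, hence the simultaneous induction: received messages
  were sent earlier, \<open>cert\<close> is assembled from received messages, and sent messages copy
  certificates from either place.\<close>

lemma authenticity:
  shows "i \<in> correct P R \<Longrightarrow> m \<in> received (state R k i) \<Longrightarrow> unforged P R k m"
    and "i \<in> correct P R \<Longrightarrow> p \<in> cert_parts (cert (state R k i)) \<Longrightarrow> authentic P R k p"
    and "sent_before R k j d m \<Longrightarrow> unforged P R k m"
proof (induction k arbitrary: i m p j d)
  case 0
  {
    case 1
    then show ?case using steps by (simp add: steps_ok_def init_state_def)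
  next
    case 2
    then show ?case using steps by (simp add: steps_ok_def init_state_def cert_parts_def)
  next
    case 3
    then show ?case by (simp add: sent_before_def)
  }
next
  case (Suc k)
  note IH = Suc
  {
    case 3
    then consider "sent_before R k j d m" | "Send j d m \<in> outputs R k"
      by (auto simp: sent_before_Suc)
    then show ?case
    proof cases
      case 1
      then show ?thesis using IH(3) unforged_mono[of P R k m "Suc k"] by simp
    next
      case 2
      show ?thesis
      proof (cases "j \<in> correct P R")
        case True
        then show ?thesis by (rule output_unforged) (use 2 IH(1,2) True in blast)+
      next
        case False
        then show ?thesis using send_origin[OF 2] unforged_mono[of P R k m "Suc k"] by simp
      qed
    qed
  next
    case 1
    show ?case using 1(1)
    proof (cases rule: step_cases[where k = k])
      case idle
      then show ?thesis using IH(1)[OF 1(1)] 1(2) unforged_mono[of P R k m "Suc k"] by simp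
    next
      case (new_view v)
      then show ?thesis using IH(1)[OF 1(1)] 1(2) unforged_mono[of P R k m "Suc k"]
        by (simp add: enter_view_def)
    next
      case (deliver j m' r)
      then have "m = m' \<or> m \<in> received (state R k i)" using 1(2) by auto
      then have "unforged P R k m" using IH(1)[OF 1(1)] IH(3) deliver(2) by blast
      then show ?thesis using unforged_mono[of P R k m "Suc k"] by simp
    next
      case (handler g s)
      then show ?thesis
        using IH(1)[OF 1(1)] 1(2) unforged_mono[of P R k m "Suc k"] effect_frame[OF handler(3)] by simp
    qed
  next
    case 2
    have "authentic P R k p"
      using 2(1)
    proof (cases rule: step_cases[where k = k])
      case idle
      then show ?thesis using IH(2)[OF 2(1)] 2(2) by simp
    next
      case (new_view v)
      then show ?thesis using IH(2)[OF 2(1)] 2(2) by (simp add: enter_view_def)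
    next
      case (deliver j m' r)
      then show ?thesis using IH(2)[OF 2(1)] 2(2) by simp
    next
      case (handler g s)
      show ?thesis
      proof (cases "\<exists>Q v h. g = PreparedQuorum Q v h")
        case True
        then obtain Q v h where g: "g = PreparedQuorum Q v h" by blast
        then have "p \<in> cert_parts (Some (prepared_cert Q v h))" using handler 2(2) by simp
        then have "p \<in> received (state R k i)"
          using g handler(2) by (auto simp: cert_parts_def prepared_cert_def enabled_def)
        then show ?thesis using IH(1)[OF 2(1)] unforged_authentic by blast
      next
        case False
        then have "cert s = cert (state R k i)" using handler(3) by (cases g) auto
        then show ?thesis using IH(2)[OF 2(1)] 2(2) handler(4) by simp
      qed
    qed
    then show ?case using authentic_mono[of P R k p "Suc k"] by simp
  }
qed

section \<open>Certificates and timers\<close>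

lemma authentic_sent:
  assumes "authentic P R k (j, m)" "j \<in> correct P R"
  shows "\<exists>d k'. k' < k \<and> Send j d (j, m) \<in> outputs R k'"
  using assms unfolding authentic_def sent_before_def by (auto simp: correct_def)

text \<open>The index is existential because certificates obtained at different moments are compared
  and only the existence of the signatures matters. The annotation fixes the value type, which does
  not occur in a certificate.\<close>

definition genuine :: "'h cert option \<Rightarrow> bool" where
  "genuine C \<longleftrightarrow> (\<exists>k. \<forall>p \<in> cert_parts C. authentic P R k (p :: ('v, 'h) smsg))"

lemma genuine_cert: "i \<in> correct P R \<Longrightarrow> genuine (cert (state R k i))"
  unfolding genuine_def using authenticity(2) by blast

lemma genuine_newleader:
  assumes "i \<in> correct P R" "(j, NEWLEADER v w y C) \<in> received (state R k i)"
  shows "genuine C"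
  using authenticity(1)[OF assms] unfolding genuine_def unforged_iff_authentic by auto

lemma genuine_member:
  assumes "genuine C" "C = Some (prepared_cert Q w h)" "j \<in> Q" "j \<in> correct P R"
  shows "\<exists>d k. Send j d (j, PREPARED w h) \<in> outputs R k"
proof -
  have "(j, PREPARED w h) \<in> cert_parts C"
    using assms by (auto simp: cert_parts_def prepared_cert_def)
  then show ?thesis using assms(1,4) authentic_sent unfolding genuine_def by blast
qed

lemma certs_agree:
  assumes "genuine C" "genuine C'" "prepared P C w h" "prepared P C' w h'"
  shows "h = h'"
proof -
  obtain Q Q' where "quorum P Q" "quorum P Q'" and C: "C = Some (prepared_cert Q w h)" "C' = Some (prepared_cert Q' w h')"
    using assms(3,4) unfolding prepared_def by blast
  then obtain j where "j \<in> Q" "j \<in> Q'" "j \<in> correct P R" using quorum_inter_correct faulty_bound by blast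
  then show ?thesis using genuine_member assms C prepared_unique by metis
qed

text \<open>A quorum meets itself in a correct process. That process checked validity of the value
  before voting, and the hash determines the value.\<close>

lemma cert_valid:
  assumes "genuine C" "prepared P C w (hash P x)"
  shows "valid P x"
proof -
  obtain Q where "quorum P Q" and C: "C = Some (prepared_cert Q w (hash P x))"
    using assms(2) unfolding prepared_def by blast
  then obtain j where j: "j \<in> Q" "j \<in> correct P R" using quorum_inter_correct faulty_bound by blast
  then obtain d k where "Send j d (j, PREPARED w (hash P x)) \<in> outputs R k"
    using genuine_member assms C by blast
  then obtain x' where "valid P x'" "hash P x = hash P x'" using prepared_output[OF j(2)] by blast
  then show ?thesis using inj_hash by metis
qed

lemma timer_value:
  assumes i: "i \<in> correct P R" and k0: "event R k0 = NewView i w" and w: "i = leader P w" "w \<noteq> 1"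
    and "curr_view (state R k i) = w"
  shows "timer (state R k i) = Some (clock R i (time R k0) + Fp P w)"
proof -
  have "1 \<le> w" using step[of k0] k0 by simp
  have "curr_view (state R k i) = w \<longrightarrow> timer (state R k i) = Some (clock R i (time R k0) + Fp P w)"
    using i
  proof (induction k rule: run_induct)
    case init
    then show ?case using \<open>1 \<le> w\<close> by (simp add: init_state_def)
  next
    case (new_view k v)
    show ?case
    proof
      assume "curr_view (state R (Suc k) i) = w"
      then have "v = w" using new_view(5) by (simp add: enter_view_def)
      moreover have "k = k0" using new_view(2) k0 calculation unique unfolding entries_unique_def by blast
      moreover have "timer (state R (Suc k) i) = (if i = leader P v \<and> v \<noteq> 1 then Some (clock R i (time R k) + Fp P v) else None)"
        using new_view(5) by (simp add: enter_view_def)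
      ultimately show "timer (state R (Suc k) i) = Some (clock R i (time R k0) + Fp P w)" using w by presburger
    qed
  next
    case (handler k g s)
    then show ?case using effect_frame[OF handler(5)] by simp
  qed simp_all
  then show ?thesis using assms by blast
qed

end

section \<open>One view after GST with a correct leader\<close>

locale good_view = hotstuff P R
  for P :: "('v, 'h) params" and R :: "('v, 'h) run" +
  fixes v :: view and EF EL :: real
  assumes v_pos: "1 \<le> v"
    and leader_correct: "leader P v \<in> correct P R"
    and entry: "\<And>i. i \<in> correct P R \<Longrightarrow> \<exists>k. event R k = NewView i v \<and> EF \<le> time R k \<and> time R k \<le> EL"
    and GST_EF: "GST R \<le> EF"
    and EL_EF: "EL \<le> EF + 2 * delta R"
    and no_later: "\<And>i k w. \<lbrakk>i \<in> correct P R; event R k = NewView i w; v < w\<rbrakk>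
      \<Longrightarrow> EL + Fp P v + 3 * delta R < time R k"
    and Fp_large: "3 * delta R < Fp P v"
begin

abbreviation T_end :: real where "T_end \<equiv> EL + Fp P v + 3 * delta R"

lemma delta_nonneg: "0 \<le> delta R"
  using params by (simp add: params_ok_def)

lemma entry_time:
  assumes "i \<in> correct P R" "event R k = NewView i v"
  shows "EF \<le> time R k" "time R k \<le> EL"
proof -
  obtain k' where "event R k' = NewView i v" "EF \<le> time R k'" "time R k' \<le> EL"
    using entry assms(1) by blast
  moreover have "k = k'" using unique assms(2) calculation(1) unfolding entries_unique_def by blast
  ultimately show "EF \<le> time R k" "time R k \<le> EL" by auto
qed

text \<open>The time bound is imposed on all indices before \<open>b\<close>, since several events
  may share one time and only the index separates the states between them.\<close>

lemma view_le:
  assumes "i \<in> correct P R" "\<And>c. c < b \<Longrightarrow> time R c \<le> T_end"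
  shows "curr_view (state R b i) \<le> v"
proof (rule ccontr)
  assume "\<not> ?thesis"
  then obtain c where "c < b" "event R c = NewView i (curr_view (state R b i))" "v < curr_view (state R b i)"
    using curr_view_entered[OF assms(1), of b] by auto
  then show False using no_later[OF assms(1)] assms(2) by fastforce
qed

lemma in_view:
  assumes "i \<in> correct P R" "\<And>c. time R c \<le> EL \<Longrightarrow> c < b" "\<And>c. c < b \<Longrightarrow> time R c \<le> T_end"
  shows "curr_view (state R b i) = v"
proof -
  obtain k where k: "event R k = NewView i v" "time R k \<le> EL" using entry assms(1) by blast
  have "state R (Suc k) i = enter_view P i (clock R i (time R k)) v (state R k i)"
    using step[of k] k(1) by simp
  then have "curr_view (state R (Suc k) i) = v" by (simp add: enter_view_def)
  moreover have "curr_view (state R (Suc k) i) \<le> curr_view (state R b i)"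
    using curr_view_mono[OF assms(1), of "Suc k" b] assms(2)[OF k(2)] by simp
  ultimately show ?thesis using view_le[OF assms(1), of b] assms(3) by simp
qed

lemma sent_view_le:
  assumes "j \<in> correct P R" "Send j d (j, m) \<in> outputs R c" "time R c \<le> T_end"
  shows "view_of m \<le> v"
proof -
  have "time R c' \<le> T_end" if "c' < Suc c" for c'
    using time_mono[of c' c] that assms(3) by simp
  then have "curr_view (state R (Suc c) j) \<le> v" by (rule view_le[OF assms(1)])
  then show ?thesis using send_view[OF assms(1,2)] by simp
qed

section \<open>Delivery and retention of messages for the view\<close>

lemma send_after_entry:
  assumes j: "j \<in> correct P R" and "Send j d (j, m) \<in> outputs R k" "view_of m = v"
  shows "EF \<le> time R k"
proof -
  have cv: "curr_view (state R (Suc k) j) = v" using send_view[OF j assms(2)] assms(3) by simp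
  then obtain k' where k': "k' < Suc k" "event R k' = NewView j v"
    using curr_view_entered[OF j, of "Suc k"] v_pos by auto
  then have "time R k' \<le> time R k" using time_mono by simp
  then show ?thesis using entry_time(1)[OF j k'(2)] by simp
qed

text \<open>Until \<open>T_end\<close>, a buffered view-\<open>v\<close> message of a correct signer cannot be displaced, because the signer
  has signed neither another message of this type for \<open>v\<close> nor one for a higher view.\<close>

lemma slot_unique:
  assumes j: "j \<in> correct P R" and m: "Send j d (j, m) \<in> outputs R k" "view_of m = v"
    and m': "authentic P R b (j, m')" "type_of m' = type_of m" "v \<le> view_of m'"
    and b: "\<And>c. c < b \<Longrightarrow> time R c \<le> T_end"
  shows "m' = m"
proof -
  obtain d' c where c: "c < b" "Send j d' (j, m') \<in> outputs R c" using authentic_sent[OF m'(1) j] by blast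
  then have "view_of m' \<le> v" using sent_view_le[OF j] b by blast
  then show ?thesis using message_unique[OF j c(2) m(1)] m m' by simp
qed

text \<open>If the receiver has not yet entered \<open>v\<close>, the message goes to the buffer.
  There it is refused only in favour of a message of the same signer and type for a view at least
  \<open>v\<close>, and \<open>slot_unique\<close> makes that one the message itself.\<close>

lemma deliver_received:
  assumes i: "i \<in> correct P R" and j: "j \<in> correct P R" and ev: "event R b = Deliver j i (j, m)"
    and vm: "view_of m = v" and b: "time R b \<le> T_end"
  shows "(j, m) \<in> received (state R (Suc b) i)"
proof -
  have sent: "sent_before R b j i (j, m)" and rec: "receive (state R b i) (j, m) (state R (Suc b) i)"
    using step[of b] ev by auto
  obtain k where k: "Send j i (j, m) \<in> outputs R k" using sent unfolding sent_before_def by blast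
  have before: "time R c \<le> T_end" if "c < b" for c using time_mono[of c b] that b by simp
  have le: "curr_view (state R b i) \<le> v" by (rule view_le[OF i before])
  have "m' = m" if "(j, m') \<in> received (state R b i)" "type_of m' = type_of m" "v \<le> view_of m'" for m'
    using slot_unique[OF j k vm _ that(2,3) before] authenticity(1)[OF i that(1)] unforged_authentic by blast
  then have dup: "p = (j, m)" if "p \<in> buffered_same_slot (state R b i) (j, m)" "v \<le> view_of (snd p)" for p
    using that by (cases p) (auto simp: buffered_same_slot_def)
  show ?thesis
  proof (cases "state R (Suc b) i = state R b i")
    case True
    show ?thesis
    proof (cases "v = curr_view (state R b i)")
      case True
      then show ?thesis using rec vm by (simp add: receive_def Let_def)
    next
      case False
      then have "v > curr_view (state R b i)" using le by simp
      then have "(\<exists>p \<in> buffered_same_slot (state R b i) (j, m). v \<le> view_of (snd p)) \<or>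
         state R (Suc b) i = state R b i\<lparr>received := insert (j, m) (received (state R b i)
            - buffered_same_slot (state R b i) (j, m))\<rparr>"
        using rec vm by (auto simp: receive_def Let_def)
      then show ?thesis
      proof
        assume "\<exists>p \<in> buffered_same_slot (state R b i) (j, m). v \<le> view_of (snd p)"
        then have "(j, m) \<in> buffered_same_slot (state R b i) (j, m)" using dup by blast
        then show ?thesis using True by (simp add: buffered_same_slot_def)
      qed simp
    qed
  next
    case False
    then show ?thesis using rec vm le by (auto simp: receive_def Let_def split: if_splits)
  qed
qed

lemma received_Suc:
  assumes i: "i \<in> correct P R" and j: "j \<in> correct P R" and "(j, m) \<in> received (state R b i)"
    and vm: "view_of m = v" and b: "time R b \<le> T_end"
  shows "(j, m) \<in> received (state R (Suc b) i)"
proof -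
  have before: "time R c \<le> T_end" if "c < b" for c using time_mono[of c b] that b by simp
  obtain d k where k: "Send j d (j, m) \<in> outputs R k"
    using authenticity(1)[OF i assms(3)] unforged_authentic authentic_sent j by blast
  show ?thesis using i
  proof (cases rule: step_cases[where k = b])
    case idle
    then show ?thesis using assms(3) by simp
  next
    case (new_view w)
    then show ?thesis using assms(3) by (simp add: enter_view_def)
  next
    case (deliver l p r)
    show ?thesis
    proof (rule ccontr)
      \<comment> \<open>A message lost on delivery was evicted by \<open>p\<close>, which has the
        same signer and type and at least the same view; by \<open>slot_unique\<close>,
        \<open>p\<close> is then the lost message, although \<open>p\<close> has just been
        inserted.\<close>
      assume no: "(j, m) \<notin> received (state R (Suc b) i)"
      then have "(j, m) \<in> buffered_same_slot (state R b i) p" "p \<in> received (state R (Suc b) i)"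
        "\<forall>m' \<in> buffered_same_slot (state R b i) p. view_of (snd m') \<le> view_of (snd p)"
        using assms(3) deliver(3) by (auto simp: receive_def Let_def split: if_splits)
      moreover obtain m' where "p = (j, m')"
        using calculation(1) by (cases p) (auto simp: buffered_same_slot_def)
      moreover have "authentic P R b p"
        using authenticity(3)[OF deliver(2)] unforged_authentic by blast
      ultimately have "m' = m"
        using slot_unique[OF j k vm _ _ _ before, where m' = m'] vm by (auto simp: buffered_same_slot_def)
      then show False using no \<open>p = (j, m')\<close> \<open>p \<in> received (state R (Suc b) i)\<close> by simp
    qed
  next
    case (handler g s)
    then show ?thesis using assms(3) effect_frame[OF handler(3)] by simp
  qed
qed

lemma received_mono:
  assumes "i \<in> correct P R" "j \<in> correct P R" "(j, m) \<in> received (state R a i)" "view_of m = v" "a \<le> b"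
    "\<And>c. c < b \<Longrightarrow> time R c \<le> T_end"
  shows "(j, m) \<in> received (state R b i)"
  using assms(5,3,6)
proof (induction rule: dec_induct)
  case (step n)
  then show ?case using received_Suc[OF assms(1,2) _ assms(4), of n] by simp
qed

lemma receipt:
  assumes i: "i \<in> correct P R" and j: "j \<in> correct P R" and m: "Send j i (j, m) \<in> outputs R k" "view_of m = v"
    and T: "time R k + delta R \<le> T"
    and b: "\<And>c. time R c \<le> T \<Longrightarrow> c < b" "\<And>c. c < b \<Longrightarrow> time R c \<le> T_end"
  shows "(j, m) \<in> received (state R b i)"
proof -
  \<comment> \<open>The delivery bound covers only messages sent from GST on; a message for
    \<open>v\<close> is sent after its sender entered \<open>v\<close>.\<close>
  have "GST R \<le> time R k" using send_after_entry[OF j m] GST_EF by simp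
  then obtain k' where k': "event R k' = Deliver j i (j, m)" "time R k' \<le> time R k + delta R"
    using delivery i j m(1) unfolding delivery_ok_def by blast
  have "k' < b" using b(1) k'(2) T by simp
  then show ?thesis
    using deliver_received[OF i j k'(1) m(2)] received_mono[OF i j _ m(2), of "Suc k'" b] b(2) by simp
qed

section \<open>Snapshots: the state after all events up to a given time\<close>

definition snap :: "real \<Rightarrow> nat \<Rightarrow> bool" where
  "snap T b \<longleftrightarrow> (\<forall>c. c < b \<longleftrightarrow> time R c \<le> T)"

text \<open>Time diverges, so only finitely many events happen up to \<open>T\<close>.\<close>

lemma snap_exists: "\<exists>b. snap T b"
proof -
  let ?b = "LEAST k. T < time R k"
  have ex: "\<exists>k. T < time R k" using times by (simp add: time_ok_def)
  have "c < ?b \<longleftrightarrow> time R c \<le> T" for c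
  proof
    assume "c < ?b" then show "time R c \<le> T" using not_less_Least by fastforce
  next
    assume "time R c \<le> T"
    then show "c < ?b" using LeastI_ex[OF ex] time_mono[of ?b c] by (meson leI less_le_trans not_le)
  qed
  then show ?thesis unfolding snap_def by blast
qed

text \<open>The next event is strictly later than \<open>T\<close>, so real time passes in the
  snapshot state and zero-time processing leaves nothing enabled there. A guard that holds can only
  be blocked by \<open>handled\<close>.\<close>

lemma snap_handled:
  assumes i: "i \<in> correct P R" and T: "EL \<le> T" and b: "snap T b"
    and g: "guard P i (clock R i T) (state R b i) g"
  shows "g \<in> handled (state R b i)"
proof -
  \<comment> \<open>Some event must precede the snapshot: \<open>zero_time_processing\<close> speaks
    only of states reached by a step.\<close>
  obtain k where "time R k \<le> EL" using entry i by blast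
  then have "k < b" using b T unfolding snap_def by fastforce
  then obtain c where c: "b = Suc c" by (cases b) auto
  have "time R c \<le> T" "T < time R (Suc c)"
    using b[unfolded snap_def, rule_format, of c] b[unfolded snap_def, rule_format, of "Suc c"] c by auto
  then have "\<not> enabled P i (clock R i T) (state R b i) g"
    using zero_time i c unfolding zero_time_processing_def by blast
  then show ?thesis using g unfolding enabled_def by blast
qed

lemma snap_in_view:
  assumes "i \<in> correct P R" "EL \<le> T" "T \<le> T_end" "snap T b"
  shows "curr_view (state R b i) = v"
  using in_view[OF assms(1), of b] assms(2-4) unfolding snap_def by (meson order_trans)

lemma snap_receipt:
  assumes "i \<in> correct P R" "j \<in> correct P R" "Send j i (j, m) \<in> outputs R k" "view_of m = v"
    "time R k + delta R \<le> T" "T \<le> T_end" "snap T b"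
  shows "(j, m) \<in> received (state R b i)"
  using receipt[OF assms(1-5), of b] assms(6,7) unfolding snap_def by (meson order_trans)

section \<open>The proposal of the leader and its acceptance\<close>

abbreviation ldr :: pid where "ldr \<equiv> leader P v"

lemma leader_proposes:
  "\<exists>k x C. time R k \<le> EL + Fp P v \<and>
     (\<forall>d \<in> procs P. Send ldr d (ldr, PROPOSE v x C) \<in> outputs R k) \<and>
     (v = 1 \<and> x = myval P ldr \<or>
      EL + delta R < time R k \<and> leader_proposal P ldr (state R k ldr) v (PROPOSE v x C))"
proof -
  obtain k0 where k0: "event R k0 = NewView ldr v" "EF \<le> time R k0" "time R k0 \<le> EL"
    using entry leader_correct by blast
  show ?thesis
  proof (cases "v = 1")
    case True
    have "outputs R k0 = enter_view_out P ldr v (state R k0 ldr)" using step[of k0] k0(1) by simp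
    then have "\<forall>d \<in> procs P. Send ldr d (ldr, PROPOSE v (myval P ldr) None) \<in> outputs R k0"
      using True by (simp add: enter_view_out_def)
    moreover have "time R k0 \<le> EL + Fp P v" using k0(3) Fp_large delta_nonneg by simp
    ultimately show ?thesis using True by blast
  next
    case False
    \<comment> \<open>The real time at which the leader's timer expires. Its entry is no earlier
      than \<open>EF\<close>, and \<open>EL\<close> exceeds \<open>EF\<close> by at most 2 \<delta>,
      so \<open>Fp P v\<close> above 3 \<delta> puts \<open>T\<close> strictly after
      \<open>EL + delta R\<close>.\<close>
    define T where "T = time R k0 + Fp P v"
    have T: "EL + delta R < T" "T \<le> EL + Fp P v" "GST R \<le> time R k0"
      using k0 EL_EF Fp_large GST_EF unfolding T_def by linarith+
    have clk: "clock R ldr t - clock R ldr (time R k0) = t - time R k0" if "time R k0 \<le> t" for t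
      using clocks leader_correct T(3) that unfolding clocks_ok_def by blast
    note timer = timer_value[OF leader_correct k0(1) refl False]
    obtain b where b: "snap T b" using snap_exists by blast
    have "curr_view (state R b ldr) = v"
      by (rule snap_in_view[OF leader_correct _ _ b]) (use T delta_nonneg in linarith)+
    moreover have "clock R ldr T = clock R ldr (time R k0) + Fp P v"
      using clk[of T] Fp_large delta_nonneg unfolding T_def by simp
    ultimately have "guard P ldr (clock R ldr T) (state R b ldr) (LeaderTimeout v)"
      using timer[of b] by simp
    then have "LeaderTimeout v \<in> handled (state R b ldr)"
      using snap_handled[OF leader_correct _ b] T delta_nonneg by simp
    then obtain k where k: "k < b" "event R k = Handler ldr (LeaderTimeout v)"
      using handled_event(2)[OF leader_correct] by blast
    have g: "guard P ldr (clock R ldr (time R k)) (state R k ldr) (LeaderTimeout v)"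
      and "\<exists>s. effect P ldr (state R k ldr) (LeaderTimeout v) s (outputs R k)"
      using handler_event[OF k(2)] by blast+
    then obtain m where m: "leader_proposal P ldr (state R k ldr) v m" "outputs R k = send_all P ldr m"
      by auto
    then obtain x C where mx: "m = PROPOSE v x C" by (auto simp: leader_proposal_def Let_def split: if_splits)
    have cv: "curr_view (state R k ldr) = v" using g by simp
    then obtain k' where "k' < k" "event R k' = NewView ldr v"
      using curr_view_entered[OF leader_correct, of k] v_pos by auto
    then have "k0 < k" using k0(1) unique unfolding entries_unique_def by blast
    then have "time R k0 \<le> time R k" using time_mono by simp
    \<comment> \<open>The guard bounds the moment of the proposal from below by \<open>T\<close>,
      because clocks run at real rate after GST; the snapshot \<open>b\<close> bounds it from
      above.\<close>
    then have "T \<le> time R k" using clk[of "time R k"] g timer[OF cv] unfolding T_def by simp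
    then have "EL + delta R < time R k" using T by simp
    moreover have "\<forall>d \<in> procs P. Send ldr d (ldr, PROPOSE v x C) \<in> outputs R k" using m(2) mx by simp
    moreover have "time R k \<le> EL + Fp P v" using b k(1) T(2) unfolding snap_def by fastforce
    ultimately show ?thesis using m(1) mx by blast
  qed
qed

lemma safe_at_correct:
  assumes i: "i \<in> correct P R" and s: "curr_view (state R b i) = v" "voted (state R b i) = Some False"
    and x: "time R k \<le> EL + Fp P v"
     "v = 1 \<and> x = myval P ldr \<or>
      EL + delta R < time R k \<and> leader_proposal P ldr (state R k ldr) v (PROPOSE v x C)"
  shows "safe_proposal P (state R b i) (ldr, PROPOSE v x C)"
proof -
  let ?s = "state R b i"
  have wf: "wf_state P ?s" using wf_reachable i by blast
  have pv: "prepared_view ?s < v" "locked_view ?s = prepared_view ?s"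
    using wf s unfolding wf_state_def by auto
  have myval: "valid P (myval P ldr)" using params leader_correct by (simp add: params_ok_def)
  from x(2) show ?thesis
  proof
    assume "v = 1 \<and> x = myval P ldr"
    then show ?thesis using pv myval by simp
  next
    assume lp: "EL + delta R < time R k \<and> leader_proposal P ldr (state R k ldr) v (PROPOSE v x C)"
    let ?M = "new_leader_msgs P (state R k ldr) v"
    obtain k' where k': "Send i ldr (i, NEWLEADER v (prepared_view ?s) (prepared_val ?s) (cert ?s)) \<in> outputs R k'"
      using newleader_sent[OF i s(2)] s(1) by auto
    then have "time R k' \<le> EL" using newleader_output[OF i k'] entry_time(2)[OF i] by blast
    \<comment> \<open>Strictness in \<open>lp\<close> matters: even an event at exactly
      \<open>EL + delta R\<close> precedes the proposal.\<close>
    moreover have "c < k" if "time R c \<le> EL + delta R" for c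
      using time_mono[of k c] that lp by (meson leI less_le_trans not_le)
    moreover have "time R c \<le> T_end" if "c < k" for c
      using time_mono[of c k] that x(1) delta_nonneg by simp
    ultimately have "(i, NEWLEADER v (prepared_view ?s) (prepared_val ?s) (cert ?s)) \<in> received (state R k ldr)"
      using receipt[OF leader_correct i k', of "EL + delta R" k] by simp
    moreover have "valid_new_leader P (NEWLEADER v (prepared_view ?s) (prepared_val ?s) (cert ?s))"
      using pv wf by (simp add: wf_state_def)
    ultimately have own: "(i, prepared_view ?s, prepared_val ?s, cert ?s) \<in> ?M"
      by (simp add: new_leader_msgs_def)
    from leader_proposal_cases[OF conjunct2[OF lp]] show ?thesis
    proof
      \<comment> \<open>The process's own report is in \<open>?M\<close>, so the fallback proposal
        forces its lock to be 0.\<close>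
      assume "x = myval P ldr \<and> C = None \<and> (\<forall>(j, u, y, D) \<in> ?M. u = 0)"
      then show ?thesis using own pv myval by fastforce
    next
      assume "\<exists>j u. (j, u, Some x, C) \<in> ?M \<and> u \<noteq> 0 \<and> (\<forall>(j', u', y', C') \<in> ?M. u' \<le> u)"
      then obtain j u where best: "(j, u, Some x, C) \<in> ?M" "u \<noteq> 0" "prepared_view ?s \<le> u"
        using own by fastforce
      then have u: "u < v" "prepared P C u (hash P x)"
        and rec: "(j, NEWLEADER v u (Some x) C) \<in> received (state R k ldr)"
        by (auto simp: new_leader_msgs_def)
      \<comment> \<open>The winning report may come from a faulty process. Only the signatures in
        its certificate are relied upon.\<close>
      have C: "genuine C" using genuine_newleader[OF leader_correct rec] .
      have "valid P x" using cert_valid[OF C u(2)] .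
      moreover have "Some x = prepared_val ?s" if eq: "prepared_view ?s = u"
      proof -
        obtain y where y: "prepared_val ?s = Some y" "prepared P (cert ?s) u (hash P y)"
          using wf best(2) unfolding wf_state_def eq by blast
        then show ?thesis using certs_agree[OF C genuine_cert[OF i] u(2) y(2)] inj_hash by auto
      qed
      \<comment> \<open>A certificate for the locked view carries the locked value; one for a higher
        view satisfies the second alternative of \<open>safe_proposal\<close>.\<close>
      ultimately show ?thesis using u best(3) pv(2) by (cases "prepared_view ?s = u") auto
    qed
  qed
qed

section \<open>Voting, locking and deciding\<close>

lemma decides:
  assumes i: "i \<in> correct P R"
  shows "\<exists>t \<le> T_end. decides_at R i v t"
proof -
  obtain k x C where k: "time R k \<le> EL + Fp P v"
    "\<And>d. d \<in> procs P \<Longrightarrow> Send ldr d (ldr, PROPOSE v x C) \<in> outputs R k"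
    "v = 1 \<and> x = myval P ldr \<or>
      EL + delta R < time R k \<and> leader_proposal P ldr (state R k ldr) v (PROPOSE v x C)"
    using leader_proposes by blast
  have bounds: "0 \<le> delta R" "0 < Fp P v" using delta_nonneg Fp_large by linarith+
  \<comment> \<open>Claimed for every snapshot of the window, since the guards of the two later
    phases also refer to \<open>voted\<close> or \<open>curr_val\<close>.\<close>
  have votes: "voted (state R b j) = Some True \<and> curr_val (state R b j) = Some x \<and>
      sent b j (PREPARED v (hash P x))"
    if j: "j \<in> correct P R" and T: "EL + Fp P v + delta R \<le> T" "T \<le> T_end" and b: "snap T b" for j T b
  proof -
    have ELT: "EL \<le> T" using T bounds by simp
    have cv: "curr_view (state R b j) = v" using snap_in_view[OF j ELT T(2) b] .
    have "time R k + delta R \<le> T" using k(1) T by simp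
    then have rec: "(ldr, PROPOSE v x C) \<in> received (state R b j)"
      using snap_receipt[OF j leader_correct k(2)[OF correct_in_procs[OF j]] _ _ T(2) b] by simp
    have True: "voted (state R b j) = Some True"
    proof (rule ccontr)
      assume no: "voted (state R b j) \<noteq> Some True"
      moreover have "voted (state R b j) \<noteq> None" using wf_reachable[OF j, of b] cv v_pos by (simp add: wf_state_def)
      ultimately have vf: "voted (state R b j) = Some False" by auto
      then have "guard P j (clock R j T) (state R b j) (ProposeReceived (ldr, PROPOSE v x C))"
        using safe_at_correct[OF j cv vf k(1,3)] rec cv by simp
      then have "ProposeReceived (ldr, PROPOSE v x C) \<in> handled (state R b j)" using snap_handled[OF j ELT b] by blast
      then show False using handled_propose_voted[OF j] cv no by fastforce
    qed
    then obtain x' C' where x': "curr_val (state R b j) = Some x'" "sent b j (PREPARED v (hash P x'))"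
      "(ldr, PROPOSE v x' C') \<in> received (state R b j)"
      using voted_proposal[OF j, of b] cv by auto
    \<comment> \<open>The vote may have been triggered by another message than the one found above,
      but the correct leader signs only one proposal for \<open>v\<close>.\<close>
    obtain d c where "Send ldr d (ldr, PROPOSE v x' C') \<in> outputs R c"
      using authentic_sent[OF unforged_authentic[OF authenticity(1)[OF j x'(3)]] leader_correct] by blast
    then have "PROPOSE v x' C' = PROPOSE v x C"
      using message_unique[OF leader_correct _ k(2)[OF correct_in_procs[OF j]]] by simp
    then show ?thesis using True x' by simp
  qed
  \<comment> \<open>All members of \<open>Q\<close> being correct, every one of their messages
    arrives, and the same \<open>Q\<close> instantiates both quorum triggers.\<close>
  obtain Q where Q: "quorum P Q" "Q \<subseteq> correct P R" using correct_quorum faulty_bound by blast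
  have from_quorum: "\<forall>l \<in> Q. (l, m) \<in> received (state R b j)"
    if j: "j \<in> correct P R" and m: "\<And>l. l \<in> Q \<Longrightarrow> sent b' l m" "view_of m = v"
      and b: "snap T b" "snap T' b'" "T' + delta R \<le> T" "T \<le> T_end" for j m T b T' b'
  proof
    fix l assume l: "l \<in> Q"
    then obtain c where "c < b'" "Send l j (l, m) \<in> outputs R c"
      using m(1) correct_in_procs[OF j] unfolding sent_def sent_before_def by blast
    moreover have "time R c + delta R \<le> T" using b calculation(1) unfolding snap_def by fastforce
    ultimately show "(l, m) \<in> received (state R b j)"
      using snap_receipt[OF j _ _ m(2) _ b(4,1)] l Q(2) by blast
  qed
  \<comment> \<open>By \<open>T1\<close> all correct processes have voted, by \<open>T2\<close> they
    are locked and have sent \<open>COMMITTED\<close>; each phase costs one \<delta> and the next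
    ends at \<open>T_end\<close>.\<close>
  define T1 T2 where "T1 = EL + Fp P v + delta R" and "T2 = T1 + delta R"
  obtain b1 b2 b where b1: "snap T1 b1" and b2: "snap T2 b2" and b: "snap T_end b"
    using snap_exists by metis
  have T: "EL \<le> T1" "EL \<le> T2" "T1 \<le> T2" "T2 + delta R = T_end" "T1 \<le> T_end" "T2 \<le> T_end" "EL \<le> T_end"
    using bounds unfolding T1_def T2_def by linarith+
  have locks: "locked_view (state R b' j) = v \<and> sent b' j (COMMITTED v (hash P x))"
    if j: "j \<in> correct P R" and T': "T2 \<le> T'" "T' \<le> T_end" and b': "snap T' b'" for j b' T'
  proof -
    have ELT: "EL \<le> T'" and T1': "T1 \<le> T'" "T1 + delta R \<le> T'" using T T' unfolding T2_def by linarith+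
    have cv: "curr_view (state R b' j) = v" using snap_in_view[OF j ELT T'(2) b'] .
    have "\<forall>l \<in> Q. (l, PREPARED v (hash P x)) \<in> received (state R b' j)"
    proof (rule from_quorum[OF j _ _ b' b1 T1'(2) T'(2)])
      show "sent b1 l (PREPARED v (hash P x))" if "l \<in> Q" for l
        using votes[OF _ _ T(5) b1] Q(2) that by (auto simp: T1_def)
    qed simp
    then have "guard P j (clock R j T') (state R b' j) (PreparedQuorum Q v (hash P x))"
      using cv Q(1) votes[OF j _ T'(2) b'] T1'(1) by (simp add: T1_def)
    then show ?thesis using snap_handled[OF j ELT b'] handled_prepared[OF j] cv by blast
  qed
  have "\<forall>l \<in> Q. (l, COMMITTED v (hash P x)) \<in> received (state R b i)"
  proof (rule from_quorum[OF i _ _ b b2])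
    show "sent b2 l (COMMITTED v (hash P x))" if "l \<in> Q" for l
      using locks[OF _ _ T(6) b2] Q(2) that by auto
  qed (use T in auto)
  moreover have "curr_view (state R b i) = v" using snap_in_view[OF i T(7) _ b] by simp
  moreover have "locked_view (state R b i) = v" using locks[OF i _ _ b] T by simp
  moreover have "curr_val (state R b i) = Some x" using votes[OF i _ _ b] T by (simp add: T1_def)
  ultimately have "guard P i (clock R i T_end) (state R b i) (CommittedQuorum Q v (hash P x))"
    using Q(1) by simp
  then have "CommittedQuorum Q v (hash P x) \<in> handled (state R b i)" using snap_handled[OF i T(7) b] by blast
  then obtain c where c: "c < b" "event R c = Handler i (CommittedQuorum Q v (hash P x))"
    using handled_event(2)[OF i] by blast
  \<comment> \<open>The handler may have run before the snapshot, so view and decided value are read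
    off its guard at \<open>c\<close>.\<close>
  then obtain y where "curr_view (state R c i) = v" "curr_val (state R c i) = Some y"
    "outputs R c = {Decide i y}"
    using handler_event[OF c(2)] by auto
  moreover have "time R c \<le> T_end" using b c(1) unfolding snap_def by blast
  ultimately show ?thesis unfolding decides_at_def by blast
qed

end

section \<open>From the synchronizer specification to the good view\<close>

theorem theorem10:
  fixes P :: "('v, 'h) params" and R :: "('v, 'h) run"
    and F :: "nat \<Rightarrow> real" and V v :: nat
  assumes "hotstuff_run P R"
    and "timeout_function F"
    and "1 \<le> V"
    and "synchronizer_spec P R F V (2 * delta R)"
    and "V \<le> v"
    and "Fp P v > 3 * delta R"
    and "F v - Fp P v > 5 * delta R"
    and "leader P v \<in> correct P R"
  shows "\<forall>i \<in> correct P R. \<exists>t \<le> E_last P R v + Fp P v + 3 * delta R. decides_at R i v t"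
proof -
  note sync = assms(4)[unfolded synchronizer_spec_def]
  interpret hotstuff P R
    by unfold_locales (use assms(1) sync in blast)+
  have fin: "finite (entry_times P R w)" for w
  proof -
    have "entry_times P R w \<subseteq> (\<lambda>i. E_proc R i w) ` procs P"
      by (auto simp: entry_times_def correct_def)
    then show ?thesis by (rule finite_subset) (simp add: procs_def)
  qed
  have mem: "E_first P R w \<le> time R k" "time R k \<le> E_last P R w"
    if "i \<in> correct P R" "event R k = NewView i w" for i k w
  proof -
    have "time R k \<in> entry_times P R w"
      using that E_proc_eq[OF that(2)] enteredI[OF that(2)] unfolding entry_times_def by force
    then show "E_first P R w \<le> time R k" "time R k \<le> E_last P R w"
      using fin unfolding E_first_def E_last_def by auto
  qed
  have F_nonneg: "0 \<le> F w" for w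
    using assms(2) unfolding timeout_function_def by (metis monoD le0)
  \<comment> \<open>(P2) concerns only \<open>V\<close>; by (P5) and nonnegativity of
    \<open>F\<close>, first entries never move back from there on.\<close>
  have after_GST: "GST R \<le> E_first P R w" if "V \<le> w" for w
    using that
  proof (induction rule: dec_induct)
    case base
    then show ?case using sync by blast
  next
    case (step w)
    then have "E_first P R w + F w \<le> E_first P R (Suc w)" using sync by (metis Suc_eq_plus1)
    then show ?case using step.IH F_nonneg[of w] by linarith
  qed
  have all_enter: "\<exists>k. event R k = NewView i w" if "i \<in> correct P R" "V \<le> w" for i w
    using sync that unfolding entered_def enters_def by blast
  have spread: "E_last P R v \<le> E_first P R v + 2 * delta R"
    and gap: "E_first P R v + F v \<le> E_first P R (v + 1)"
    using sync assms(5) by auto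
  interpret good_view P R v "E_first P R v" "E_last P R v"
  proof
    show "1 \<le> v" "leader P v \<in> correct P R" "3 * delta R < Fp P v" using assms by auto
    show "\<exists>k. event R k = NewView i v \<and> E_first P R v \<le> time R k \<and> time R k \<le> E_last P R v"
      if "i \<in> correct P R" for i
      using all_enter[OF that assms(5)] mem[OF that] by blast
    show "GST R \<le> E_first P R v" "E_last P R v \<le> E_first P R v + 2 * delta R"
      using after_GST assms(5) spread by auto
    show "E_last P R v + Fp P v + 3 * delta R < time R k"
      if i: "i \<in> correct P R" and k: "event R k = NewView i w" and w: "v < w" for i k w
    proof -
      obtain k' where k': "event R k' = NewView i (v + 1)" using all_enter[OF i, of "v + 1"] assms(5) by auto
      \<comment> \<open>Views are entered in increasing order, so a view above \<open>v\<close> is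
        not entered before \<open>v + 1\<close>.\<close>
      have "k' \<le> k" using entry_order[OF i k k'] w by (cases "k < k'") auto
      then have "time R k' \<le> time R k" by (rule time_mono)
      \<comment> \<open>Origin of the 5 \<delta>: 2 \<delta> pay for the spread between first and
        last entry, and 3 \<delta> for the three message delays after the leader's wait.\<close>
      then show ?thesis using mem(1)[OF i k'] gap spread assms(7) by linarith
    qed
  qed
  show ?thesis using decides by blast
qed

end
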